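(* Let $\mathbf{A}$ be an $n\times n$ real symmetric matrix, and let $0<\eta<1$ and $t>0$. Let $n_{\mathrm{v}}$ and $k$ be positive integers with $n_{\mathrm{v}} > 4(n+2)^{-1}t^{-2}\ln(2n\eta^{-1})$ and $k > 12t^{-1}+\tfrac12$. Let $\mathbf{v}_1,\dots,\mathbf{v}_{n_{\mathrm{v}}}$ be drawn independently and uniformly from the unit sphere $\mathcal{S}^{n-1}\subset\mathbb{R}^n$, set $\Psi_i=\Psi[\mathbf{A},\mathbf{v}_i]$, and let the stochastic Lanczos quadrature output be $\frac{1}{n_{\mathrm{v}}}\sum_{i=1}^{n_{\mathrm{v}}}\mathrm{GQ}_k(\Psi_i)$. Then $$\mathbb{P}\Big[d_{\mathrm{W}}\Big(\Phi[\mathbf{A}],\ \tfrac{1}{n_{\mathrm{v}}}\textstyle\sum_{i=1}^{n_{\mathrm{v}}}\mathrm{GQ}_k(\Psi_i)\Big) > t\, I[\mathbf{A}]\Big] < \eta,$$ where $I[\mathbf{A}] := |\lambda_{\max}[\mathbf{A}]-\lambda_{\min}[\mathbf{A}]|$.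
   Context: For a symmetric matrix $\mathbf{A}$ with eigendecomposition $\mathbf{A}=\mathbf{U}\boldsymbol{\Lambda}\mathbf{U}^{\mathsf T}$ and $x\in\mathbb{R}$, $\mathbb{1}[\mathbf{A}\le x]$ denotes the orthogonal projector onto the span of eigenvectors whose eigenvalues are $\le x$. The cumulative empirical spectral measure (CESM) is $\Phi[\mathbf{A}](x)=\frac1n\sum_{i=1}^n\mathbb{1}[\lambda_i[\mathbf{A}]\le x]=\frac1n\operatorname{tr}(\mathbb{1}[\mathbf{A}\le x])$. For a unit vector $\mathbf{v}$, the weighted CESM is $\Psi[\mathbf{A},\mathbf{v}](x)=\mathbf{v}^{\mathsf T}\mathbb{1}[\mathbf{A}\le x]\mathbf{v}$, a probability distribution function. For a probability distribution function $\mu$, the $k$-point Gaussian quadrature rule $\mathrm{GQ}_k(\mu)$ is the distribution function $\nu(x)=\sum_{j=1}^k d_j\mathbb{1}[\theta_j\le x]$ (nodes $\theta_j$, nonnegative weights $d_j$) such that $\int p\,d\mu=\int p\,d\nu$ for all polynomials $p$ of degree $\le 2k-1$; for $\mu=\Psi[\mathbf{A},\mathbf{v}]$ it equals $\Psi[\mathbf{T}_k,\hat{\mathbf{e}}]$, where $\mathbf{T}_k$ is the $k\times k$ tridiagonal matrix produced by $k$ steps of the Lanczos algorithm on $\mathbf{A},\mathbf{v}$ and $\hat{\mathbf{e}}=(1,0,\dots,0)^{\mathsf T}$ (its nodes are the eigenvalues of $\mathbf{T}_k$ and weights the squared first components of its normalized eigenvectors). The Wasserstein distance between distribution functions is $d_{\mathrm{W}}(\mu,\nu)=\int_{\mathbb{R}}|\mu(x)-\nu(x)|\,dx$.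 *)

theory Defs
  imports "HOL-Analysis.Analysis" "HOL-Computational_Algebra.Polynomial"
begin

definition low_eigvecs :: "real^'n^'n \<Rightarrow> real \<Rightarrow> (real^'n) set" where
  "low_eigvecs A x = {v. v \<noteq> 0 \<and> (\<exists>l. l \<le> x \<and> A *v v = l *\<^sub>R v)}"

definition orth_proj :: "(real^'n) set \<Rightarrow> real^'n \<Rightarrow> real^'n" where
  "orth_proj S v = (THE p. p \<in> S \<and> (\<forall>w\<in>S. (v - p) \<bullet> w = 0))"

definition spec_proj :: "real^'n^'n \<Rightarrow> real \<Rightarrow> real^'n^'n" where
  "spec_proj A x = matrix (orth_proj (span (low_eigvecs A x)))"

definition CESM :: "real^'n^'n \<Rightarrow> real \<Rightarrow> real" where
  "CESM A x = trace (spec_proj A x) / real CARD('n)"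

definition wCESM :: "real^'n^'n \<Rightarrow> real^'n \<Rightarrow> real \<Rightarrow> real" where
  "wCESM A v x = v \<bullet> (spec_proj A x *v v)"

definition GQ :: "nat \<Rightarrow> (real \<Rightarrow> real) \<Rightarrow> real \<Rightarrow> real" where
  "GQ k mu = (THE nu. \<exists>(theta::nat \<Rightarrow> real) (d::nat \<Rightarrow> real).
      (\<forall>j<k. d j \<ge> 0) \<and>
      nu = (\<lambda>x. \<Sum>j<k. d j * (if theta j \<le> x then 1 else 0)) \<and>
      (\<forall>p::real poly. degree p \<le> 2*k - 1 \<longrightarrow>
          (\<integral>x. poly p x \<partial>(interval_measure mu)) = (\<Sum>j<k. d j * poly p (theta j))))"

definition dW :: "(real \<Rightarrow> real) \<Rightarrow> (real \<Rightarrow> real) \<Rightarrow> real" where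
  "dW mu nu = (\<integral>x. \<bar>mu x - nu x\<bar> \<partial>lborel)"

definition eigenvalues :: "real^'n^'n \<Rightarrow> real set" where
  "eigenvalues A = {l. \<exists>v. v \<noteq> 0 \<and> A *v v = l *\<^sub>R v}"

definition spec_width :: "real^'n^'n \<Rightarrow> real" where
  "spec_width A = \<bar>Max (eigenvalues A) - Min (eigenvalues A)\<bar>"

(* Uniform distribution on the unit sphere S^{n-1}: the normalized surface (cone)
   measure, realized as the pushforward of the uniform distribution on the unit
   ball under radial projection x \<mapsto> x/|x|. *)
definition sphere_unif :: "(real^'n) measure" where
  "sphere_unif = distr (uniform_measure lborel (ball 0 1)) borel (\<lambda>x. x /\<^sub>R norm x)"

definition SLQ :: "real^'n^'n \<Rightarrow> nat \<Rightarrow> nat \<Rightarrow> (nat \<Rightarrow> real^'n) \<Rightarrow> real \<Rightarrow> real" where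
  "SLQ A k nv vs x = (\<Sum>i<nv. GQ k (wCESM A (vs i)) x) / real nv"

end

theory Submission
  imports Defs "HOL-Probability.Probability"
begin

text \<open>
  The error splits into the sampling error \<open>\<Phi> - avg \<Psi>\<^sub>i\<close> and the quadrature errors
  \<open>\<Psi>\<^sub>i - GQ \<Psi>\<^sub>i\<close>. A quadrature error is the integral of a 1-Lipschitz function against a signed
  measure annihilating polynomials of degree \<open>2k - 1\<close>, so Jackson's theorem bounds it by
  \<open>pi I[A] / (2k + 1)\<close>. In an eigenbasis the sampling error at a point is governed by the squared norm
  \<open>X\<close> of the projection of a random unit vector to an \<open>m\<close>-dimensional coordinate subspace. Computing
  the volume of an ellipsoid in polar coordinates gives \<open>E (1 - z X)^(-n/2) = (1 - z)^(-m/2)\<close>, and a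
  Chernoff argument with Pinsker's inequality turns this into the tail bound \<open>exp (- n nv r\<^sup>2)\<close> for the
  average of \<open>nv\<close> samples. A union bound over the eigenvalues finishes the proof.
\<close>

section \<open>Jackson's theorem for Lipschitz functions\<close>

text \<open>Jackson's bound is needed with an explicit constant, so it is proved with a positive
  kernel; averages over \<open>s + 2\<close> equispaced angles replace the convolution integrals,
  and everything stays a finite sum. \<open>GQ\<close> is a definite description: a Gauss rule has
  to be constructed, and its distribution function shown unique, before anything can be said of it.
  The coordinates of a uniform unit vector are dependent, but \<open>(1 - z X)^(-n/2)\<close> has an
  exact mean because it is the \<open>n\<close>-th power of the radial function of an ellipsoid,
  whose volume is known. A tangent line turns this function into an exponential of \<open>X\<close>,
  which multiplies over independent samples. The conclusion speaks of a measurable cover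
  \<open>B\<close> of the bad event: the distance depends on the samples through \<open>GQ\<close>,
  and its measurability is not examined, whereas deviations of projected norms at the finitely many
  eigenvalues are plainly measurable.\<close>

text \<open>Chebyshev polynomials of the first kind, from cos((i+2)x) = 2 cos x cos((i+1)x) -
  cos(ix).\<close>

lemma cos_multiple_poly:
  "\<exists>T::real poly. degree T \<le> j \<and> (\<forall>x. cos (real j * x) = poly T (cos x))"
proof (induction j rule: less_induct)
  case (less j)
  consider "j = 0" | "j = 1" | i where "j = Suc (Suc i)"
    by (metis One_nat_def not0_implies_Suc)
  then show ?case
  proof cases
    case 1 then show ?thesis by (intro exI[of _ 1]) auto
  next
    case 2 then show ?thesis by (intro exI[of _ "[:0,1:]"]) auto
  next
    case 3
    obtain S T :: "real poly" where S: "degree S \<le> i" "\<And>x. cos (real i * x) = poly S (cos x)"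
      and T: "degree T \<le> Suc i" "\<And>x. cos (real (Suc i) * x) = poly T (cos x)"
      using less[of i] less[of "Suc i"] 3 by auto
    have "degree ([:0,2:] * T - S) \<le> j"
      using S(1) T(1) 3 by (intro degree_diff_le order.trans[OF degree_mult_le]) auto
    moreover have "cos (real j * x) = poly ([:0,2:] * T - S) (cos x)" for x
    proof -
      have "cos (real j * x) + cos (real i * x) = 2 * cos x * cos (real (Suc i) * x)"
        unfolding 3 using cos_times_cos[of "real (Suc i) * x" x] by (simp add: algebra_simps)
      then show ?thesis using S(2)[of x] T(2)[of x] by (simp add: algebra_simps)
    qed
    ultimately show ?thesis by blast
  qed
qed

lemma cos_int_multiple_poly:
  assumes "\<bar>m\<bar> \<le> int s"
  shows "\<exists>T::real poly. degree T \<le> s \<and> (\<forall>x. cos (real_of_int m * x) = poly T (cos x))"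
proof -
  obtain T :: "real poly" where "degree T \<le> nat \<bar>m\<bar>"
      "\<And>x. cos (real (nat \<bar>m\<bar>) * x) = poly T (cos x)"
    using cos_multiple_poly by blast
  moreover have "cos (real (nat \<bar>m\<bar>) * x) = cos (real_of_int m * x)" for x
    by (cases "m \<ge> 0") (auto simp: abs_if)
  ultimately show ?thesis using assms by (intro exI[of _ T]) auto
qed

text \<open>Multiplication by \<open>2 * sin h\<close>, with \<open>h\<close> half the angular step,
  makes the sum telescope, and the two ends agree by periodicity. A zero of \<open>sin h\<close>
  would make \<open>N\<close> divide \<open>m\<close>. This discrete orthogonality lets finite
  averages stand in for integrals over a period.\<close>

lemma sum_cos_equispaced:
  fixes m :: int and N :: nat
  assumes "m \<noteq> 0" "\<bar>m\<bar> < int N"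
  shows "(\<Sum>r<N. cos (real_of_int m * (x - 2 * pi * real r / real N))) = 0"
proof -
  define h where "h = pi * real_of_int m / real N"
  have N: "real N > 0" using assms by auto
  define g where "g r = sin (real_of_int m * x - 2 * real r * h + h)" for r :: nat
  have "2 * sin h * cos (real_of_int m * (x - 2 * pi * real r / real N)) = g r - g (Suc r)" for r
  proof -
    have e: "real_of_int m * (x - 2 * pi * real r / real N) = real_of_int m * x - 2 * real r * h"
      by (simp add: h_def algebra_simps)
    have e2: "g (Suc r) = sin (real_of_int m * x - 2 * real r * h - h)"
      by (simp add: g_def algebra_simps)
    show ?thesis unfolding e e2 unfolding g_def
      using sin_add[of "real_of_int m * x - 2 * real r * h" h]
        sin_diff[of "real_of_int m * x - 2 * real r * h" h] by simp
  qed
  then have "2 * sin h * (\<Sum>r<N. cos (real_of_int m * (x - 2 * pi * real r / real N)))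
      = (\<Sum>r<N. g r - g (Suc r))"
    by (simp add: sum_distrib_left)
  also have "\<dots> = g 0 - g N"
    by (rule sum_lessThan_telescope')
  also have "\<dots> = 0"
  proof -
    have "g N = sin (real_of_int m * x + h - real_of_int m * (2 * pi))"
      using N by (simp add: g_def h_def algebra_simps)
    also have "\<dots> = sin (real_of_int m * x + h)"
      using sin.minus_of_int[of "real_of_int m * x + h" m] by simp
    finally show ?thesis by (simp add: g_def)
  qed
  finally have "2 * sin h * (\<Sum>r<N. cos (real_of_int m * (x - 2 * pi * real r / real N))) = 0" .
  moreover have "sin h \<noteq> 0"
  proof
    assume "sin h = 0"
    then obtain i :: int where "h = real_of_int i * pi" by (auto simp: sin_zero_iff_int2)
    then have "real_of_int m = real_of_int i * real N"
      using N by (simp add: h_def field_simps)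
    then have "m = i * int N" by (metis of_int_eq_iff of_int_mult of_int_of_nat_eq)
    then show False using assms
      by (metis dvd_triv_right zdvd_not_zless abs_of_nat dvd_abs_iff zero_less_abs_iff)
  qed
  ultimately show ?thesis by simp
qed

section \<open>Nonnegative trigonometric kernels and their discrete moments\<close>

text \<open>The squared modulus of the trigonometric polynomial with coefficients
  \<open>c j\<close>, multiplied out so that its frequencies \<open>j - l\<close> can be read
  off.\<close>

definition trig_kernel :: "(nat \<Rightarrow> real) \<Rightarrow> nat \<Rightarrow> real \<Rightarrow> real" where
  "trig_kernel c s u = (\<Sum>j\<le>s. \<Sum>l\<le>s. c j * c l * cos (real_of_int (int j - int l) * u))"

lemma trig_kernel_nonneg: "trig_kernel c s u \<ge> 0"
proof -
  have "trig_kernel c s u = (\<Sum>j\<le>s. c j * cos (real j * u))\<^sup>2 + (\<Sum>j\<le>s. c j * sin (real j * u))\<^sup>2"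
    unfolding trig_kernel_def power2_eq_square sum_product sum.distrib[symmetric]
    by (intro sum.cong refl) (simp add: left_diff_distrib cos_diff algebra_simps)
  then show ?thesis by simp
qed

lemma trig_kernel_minus: "trig_kernel c s (- u) = trig_kernel c s u"
  unfolding trig_kernel_def by simp

text \<open>Adding the reflected translate cancels the sines. What remains are cosines of multiples
  of \<open>x\<close> of frequency at most \<open>s\<close>, which are polynomials in
  \<open>cos x\<close>.\<close>

lemma trig_kernel_symmetrized_poly:
  "\<exists>p::real poly. degree p \<le> s \<and>
     (\<forall>x. trig_kernel c s (x - w) + trig_kernel c s (x + w) = poly p (cos x))"
proof -
  have "\<forall>j l. \<exists>T::real poly. j \<le> s \<longrightarrow> l \<le> s \<longrightarrow> degree T \<le> s \<and>
      (\<forall>x. cos (real_of_int (int j - int l) * x) = poly T (cos x))"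
  proof (intro allI)
    fix j l show "\<exists>T::real poly. j \<le> s \<longrightarrow> l \<le> s \<longrightarrow> degree T \<le> s \<and>
      (\<forall>x. cos (real_of_int (int j - int l) * x) = poly T (cos x))"
    proof (cases "j \<le> s \<and> l \<le> s")
      case True
      then have "\<bar>int j - int l\<bar> \<le> int s" by auto
      from cos_int_multiple_poly[OF this] show ?thesis by blast
    qed auto
  qed
  then obtain T :: "nat \<Rightarrow> nat \<Rightarrow> real poly" where
    T: "\<And>j l. j \<le> s \<Longrightarrow> l \<le> s \<Longrightarrow> degree (T j l) \<le> s"
       "\<And>j l x. j \<le> s \<Longrightarrow> l \<le> s \<Longrightarrow> cos (real_of_int (int j - int l) * x) = poly (T j l) (cos x)"
    by metis
  define p where "p = (\<Sum>j\<le>s. \<Sum>l\<le>s. smult (2 * c j * c l * cos (real_of_int (int j - int l) * w)) (T j l))"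
  have "degree p \<le> s"
    unfolding p_def by (intro degree_sum_le) (auto intro!: order.trans[OF degree_smult_le] T)
  moreover have "trig_kernel c s (x - w) + trig_kernel c s (x + w) = poly p (cos x)" for x
    unfolding trig_kernel_def p_def poly_sum sum.distrib[symmetric]
  proof (intro sum.cong refl)
    fix j l assume "j \<in> {..s}" "l \<in> {..s}"
    then have "poly (T j l) (cos x) = cos (real_of_int (int j - int l) * x)" using T by simp
    then show "c j * c l * cos (real_of_int (int j - int l) * (x - w)) +
        c j * c l * cos (real_of_int (int j - int l) * (x + w)) =
        poly (smult (2 * c j * c l * cos (real_of_int (int j - int l) * w)) (T j l)) (cos x)"
      by (simp only: poly_smult right_diff_distrib distrib_left cos_diff cos_add) (simp add: algebra_simps)
  qed
  ultimately show ?thesis by blast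
qed

lemma sum_trig_kernel:
  assumes "s < N"
  shows "(\<Sum>r<N. trig_kernel c s (x - 2 * pi * real r / real N)) = real N * (\<Sum>j\<le>s. (c j)\<^sup>2)"
proof -
  have e: "(\<Sum>r<N. cos (real_of_int (int j - int l) * (x - 2 * pi * real r / real N)))
      = (if l = j then real N else 0)" if "j \<le> s" "l \<le> s" for j l
    using that assms sum_cos_equispaced[of "int j - int l" N x] by auto
  have "(\<Sum>r<N. trig_kernel c s (x - 2 * pi * real r / real N))
    = (\<Sum>j\<le>s. \<Sum>l\<le>s. c j * c l * (\<Sum>r<N. cos (real_of_int (int j - int l) * (x - 2 * pi * real r / real N))))"
    unfolding trig_kernel_def sum_distrib_left
    by (subst sum.swap, rule sum.cong[OF refl], subst sum.swap, rule refl)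
  also have "\<dots> = (\<Sum>j\<le>s. \<Sum>l\<le>s. if l = j then c j * c j * real N else 0)"
    by (intro sum.cong refl, subst e) auto
  also have "\<dots> = (\<Sum>j\<le>s. c j * c j * real N)"
    by (intro sum.cong refl) simp
  also have "\<dots> = real N * (\<Sum>j\<le>s. (c j)\<^sup>2)"
    by (simp add: sum_distrib_left power2_eq_square mult.commute)
  finally show ?thesis .
qed

text \<open>The factor \<open>cos\<close> shifts each frequency by one in both directions, so
  frequencies reach \<open>s + 1\<close> and \<open>N\<close> must exceed that. Only neighbouring
  coefficients survive.\<close>

lemma sum_trig_kernel_cos:
  assumes "Suc s < N"
  shows "(\<Sum>r<N. trig_kernel c s (x - 2 * pi * real r / real N) * cos (x - 2 * pi * real r / real N))
    = real N * (\<Sum>j<s. c j * c (Suc j))"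
proof -
  let ?y = "\<lambda>r. x - 2 * pi * real r / real N"
  have prod: "cos (real_of_int m * y) * cos y = (cos (real_of_int (m+1) * y) + cos (real_of_int (m-1) * y)) / 2" for m y
  proof -
    have "real_of_int m * y - y = real_of_int (m - 1) * y" "real_of_int m * y + y = real_of_int (m + 1) * y"
      by (simp_all add: algebra_simps)
    then show ?thesis by (simp add: cos_times_cos)
  qed
  have e: "(\<Sum>r<N. cos (real_of_int (int j - int l) * ?y r) * cos (?y r))
      = (if l = Suc j then real N / 2 else 0) + (if j = Suc l then real N / 2 else 0)" if "j \<le> s" "l \<le> s" for j l
  proof -
    have "(\<Sum>r<N. cos (real_of_int (int j - int l + 1) * ?y r)) = (if l = Suc j then real N else 0)"
    proof (cases "l = Suc j")
      case False
      then show ?thesis using that assms by (subst sum_cos_equispaced) auto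
    qed simp
    moreover have "(\<Sum>r<N. cos (real_of_int (int j - int l - 1) * ?y r)) = (if j = Suc l then real N else 0)"
    proof (cases "j = Suc l")
      case False
      then show ?thesis using that assms by (subst sum_cos_equispaced) auto
    qed simp
    ultimately show ?thesis
      unfolding prod sum_divide_distrib[symmetric] sum.distrib by simp
  qed
  have "(\<Sum>r<N. trig_kernel c s (?y r) * cos (?y r))
    = (\<Sum>j\<le>s. \<Sum>l\<le>s. c j * c l * (\<Sum>r<N. cos (real_of_int (int j - int l) * ?y r) * cos (?y r)))"
    unfolding trig_kernel_def sum_distrib_left sum_distrib_right
    by (subst sum.swap, rule sum.cong[OF refl], subst sum.swap, simp add: mult.assoc)
  also have "\<dots> = (\<Sum>j\<le>s. \<Sum>l\<le>s. c j * c l * ((if l = Suc j then real N / 2 else 0) + (if j = Suc l then real N / 2 else 0)))"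
    by (intro sum.cong refl, subst e) auto
  also have "\<dots> = (\<Sum>j\<le>s. \<Sum>l\<le>s. if l = Suc j then c j * c (Suc j) * (real N / 2) else 0)
      + (\<Sum>l\<le>s. \<Sum>j\<le>s. if j = Suc l then c l * c (Suc l) * (real N / 2) else 0)"
    unfolding distrib_left sum.distrib
    by (subst (2) sum.swap) (intro arg_cong2[where f="(+)"] sum.cong refl, auto)
  also have "(\<Sum>j\<le>s. \<Sum>l\<le>s. if l = Suc j then c j * c (Suc j) * (real N / 2) else 0)
      = (\<Sum>j<s. c j * c (Suc j) * (real N / 2))"
    by (rule sum.mono_neutral_cong_right) auto
  finally show ?thesis by (simp add: sum_distrib_left sum.distrib[symmetric] algebra_simps)
qed

text \<open>Choosing \<open>c j = sin ((j + 1) \<alpha>)\<close> with \<open>\<alpha> = pi / (s + 2)\<close> maximises the first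
  Fourier coefficient of the kernel: the recurrence \<open>c (j - 1) + c (j + 1) = 2 cos \<alpha> c j\<close>
  together with the vanishing boundary values shows that it equals \<open>cos \<alpha>\<close>.\<close>

lemma sine_weights_correlation:
  fixes s :: nat
  defines "a \<equiv> pi / real (s + 2)"
  shows "(\<Sum>j<s. sin (real (j + 1) * a) * sin (real (Suc j + 1) * a))
    = cos a * (\<Sum>j\<le>s. (sin (real (j + 1) * a))\<^sup>2)"
proof -
  define c where "c j = sin (real j * a)" for j
  have top: "c (s + 2) = 0" by (simp add: c_def a_def)
  have rec: "c j + c (Suc (Suc j)) = 2 * cos a * c (Suc j)" for j
    unfolding c_def using sin_times_cos[of "real (Suc j) * a" a] by (simp add: algebra_simps)
  have "2 * cos a * (\<Sum>j\<le>s. (c (Suc j))\<^sup>2) = (\<Sum>j\<le>s. c (Suc j) * (c j + c (Suc (Suc j))))"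
    unfolding rec by (simp add: sum_distrib_left power2_eq_square algebra_simps)
  also have "\<dots> = (\<Sum>j\<le>s. c (Suc j) * c j) + (\<Sum>j\<le>s. c (Suc j) * c (Suc (Suc j)))"
    by (simp add: distrib_left sum.distrib)
  also have "(\<Sum>j\<le>s. c (Suc j) * c j) = (\<Sum>j<s. c (Suc (Suc j)) * c (Suc j))"
    by (subst sum.atMost_shift) (simp add: c_def)
  also have "(\<Sum>j\<le>s. c (Suc j) * c (Suc (Suc j))) = (\<Sum>j<s. c (Suc j) * c (Suc (Suc j)))"
    using top by (simp add: lessThan_Suc_atMost[symmetric])
  finally show ?thesis by (simp add: c_def mult.commute)
qed

text \<open>With \<open>x = cos y\<close>, the polynomial is the kernel average of \<open>f\<close>
  over cosines of equispaced angles, made even in \<open>y\<close>. Its error is at most the kernel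
  average of \<open>2 * |sin ((y - w) / 2)|\<close>, which Cauchy-Schwarz bounds by the square root
  of the average of \<open>2 - 2 * cos (y - w)\<close>. The sine weights make that root
  \<open>2 * sin (a / 2)\<close>, which is at most \<open>a = pi / (s + 2)\<close>.\<close>

theorem jackson_unit_interval:
  fixes f :: "real \<Rightarrow> real" and s :: nat
  assumes lip: "\<And>x y. x \<in> {-1..1} \<Longrightarrow> y \<in> {-1..1} \<Longrightarrow> \<bar>f x - f y\<bar> \<le> \<bar>x - y\<bar>"
  shows "\<exists>p::real poly. degree p \<le> s \<and> (\<forall>x\<in>{-1..1}. \<bar>f x - poly p x\<bar> \<le> pi / real (s + 2))"
proof -
  define a where "a = pi / real (s + 2)"
  define c where "c j = sin (real (j + 1) * a)" for j
  \<comment> \<open>The smallest number of nodes that the two moment sums \<open>K1\<close> and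
    \<open>K2\<close> admit.\<close>
  define N where "N = s + 2"
  define w where "w r = 2 * pi * real r / real N" for r
  define C where "C = (\<Sum>j\<le>s. (c j)\<^sup>2)"
  let ?K = "trig_kernel c s"
  have a: "0 < a" "a \<le> pi / 2"
    unfolding a_def by (simp_all add: field_simps)
  have C: "C > 0"
  proof -
    have "sin a > 0" using a by (intro sin_gt_zero) (auto intro: le_less_trans)
    then have "0 < (c 0)\<^sup>2" by (simp add: c_def)
    also have "\<dots> \<le> C" unfolding C_def by (rule member_le_sum) auto
    finally show ?thesis .
  qed
  have N: "real N > 0" by (simp add: N_def)
  define d where "d = 2 * sin (a / 2)"
  have d: "d > 0" using a by (auto simp: d_def intro!: sin_gt_zero)
  have d2: "2 - 2 * cos a = d\<^sup>2"
    using cos_double_sin[of "a / 2"] by (simp add: d_def power2_eq_square)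
  have K1: "(\<Sum>r<N. ?K (x - w r)) = real N * C" for x
    unfolding w_def C_def by (rule sum_trig_kernel) (simp add: N_def)
  have K2: "(\<Sum>r<N. ?K (x - w r) * cos (x - w r)) = real N * (cos a * C)" for x
    unfolding w_def C_def c_def a_def sine_weights_correlation[symmetric]
    by (subst sum_trig_kernel_cos) (simp_all add: N_def)
  \<comment> \<open>Cauchy-Schwarz, linearised as \<open>2 * y \<le> 2 * y^2 / d + d / 2\<close>;
    with this \<open>d\<close> the two terms contribute equally after summation.\<close>
  have K3: "(\<Sum>r<N. ?K (x - w r) * (2 * \<bar>sin ((x - w r) / 2)\<bar>)) \<le> real N * C * d" for x
  proof -
    have "?K (x - w r) * (2 * \<bar>sin ((x - w r) / 2)\<bar>)
        \<le> (?K (x - w r) * (1 / d + d / 2) - ?K (x - w r) * cos (x - w r) / d)" for r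
    proof -
      define y where "y = \<bar>sin ((x - w r) / 2)\<bar>"
      have "cos (x - w r) = 1 - 2 * y\<^sup>2"
        using cos_double_sin[of "(x - w r) / 2"] unfolding y_def
        by (simp only: power2_abs mult_2 field_sum_of_halves)
      moreover have "2 * y \<le> 2 * y\<^sup>2 / d + d / 2"
      proof -
        have "0 \<le> (2 * y - d)\<^sup>2" by simp
        then show ?thesis using d by (simp add: field_simps power2_eq_square)
      qed
      ultimately have "2 * y \<le> 1 / d + d / 2 - cos (x - w r) / d"
        using d by (simp add: diff_divide_distrib)
      then have "?K (x - w r) * (2 * y) \<le> ?K (x - w r) * (1 / d + d / 2 - cos (x - w r) / d)"
        by (intro mult_left_mono trig_kernel_nonneg)
      then show ?thesis by (simp add: y_def right_diff_distrib)
    qed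
    then have "(\<Sum>r<N. ?K (x - w r) * (2 * \<bar>sin ((x - w r) / 2)\<bar>))
        \<le> (\<Sum>r<N. ?K (x - w r) * (1 / d + d / 2) - ?K (x - w r) * cos (x - w r) / d)"
      by (intro sum_mono)
    also have "\<dots> = real N * C * (1 / d + d / 2) - real N * (cos a * C) / d"
      by (simp only: sum_subtractf sum_distrib_right[symmetric] sum_divide_distrib[symmetric] K1 K2)
    also have "\<dots> = real N * C * ((2 - 2 * cos a) / (2 * d) + d / 2)"
      using d by (simp add: field_simps)
    also have "\<dots> = real N * C * d"
      unfolding d2 using d by (simp add: field_simps power2_eq_square)
    finally show ?thesis .
  qed
  have "\<forall>r. \<exists>p. degree p \<le> s \<and> (\<forall>x. ?K (x - w r) + ?K (x + w r) = poly p (cos x))"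
    by (intro allI trig_kernel_symmetrized_poly)
  from choice[OF this] obtain P :: "nat \<Rightarrow> real poly" where P: "\<And>r. degree (P r) \<le> s"
    "\<And>r x. ?K (x - w r) + ?K (x + w r) = poly (P r) (cos x)"
    by blast
  \<comment> \<open>The 2 in the denominator accounts for the two translates contained in each
    \<open>P r\<close>.\<close>
  define p where "p = (\<Sum>r<N. smult (f (cos (w r)) / (2 * real N * C)) (P r))"
  have "degree p \<le> s"
    unfolding p_def by (intro degree_sum_le) (auto intro!: order.trans[OF degree_smult_le] P)
  moreover have "\<bar>f x - poly p x\<bar> \<le> pi / real (s + 2)" if "x \<in> {-1..1}" for x
  proof -
    define y where "y = arccos x"
    have x: "x = cos y" using that by (simp add: y_def cos_arccos)
    \<comment> \<open>A periodic bound: the nodes run through a full turn, so \<open>|u - v|\<close>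
      itself could be far too large.\<close>
    have half: "\<bar>cos u - cos v\<bar> \<le> 2 * \<bar>sin ((u - v) / 2)\<bar>" for u v :: real
    proof -
      have "cos u - cos v = 2 * sin ((u + v) / 2) * sin ((v - u) / 2)" by (rule cos_diff_cos)
      then have "\<bar>cos u - cos v\<bar> = 2 * \<bar>sin ((u + v) / 2)\<bar> * \<bar>sin ((v - u) / 2)\<bar>" by (simp add: abs_mult)
      also have "\<dots> \<le> 2 * 1 * \<bar>sin ((v - u) / 2)\<bar>"
        by (intro mult_right_mono mult_left_mono) auto
      also have "\<bar>sin ((v - u) / 2)\<bar> = \<bar>sin ((u - v) / 2)\<bar>"
        by (metis abs_minus_cancel minus_diff_eq minus_divide_left sin_minus)
      finally show ?thesis by simp
    qed
    have bnd: "\<bar>f x - f (cos (w r))\<bar> \<le> 2 * \<bar>sin ((y - w r) / 2)\<bar>"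
              "\<bar>f x - f (cos (w r))\<bar> \<le> 2 * \<bar>sin ((- y - w r) / 2)\<bar>" for r
      using lip[of x "cos (w r)"] half[of y "w r"] half[of "-y" "w r"] that x by auto
    have pp: "2 * real N * C * poly p x = (\<Sum>r<N. f (cos (w r)) * (?K (y - w r) + ?K (- y - w r)))"
    proof -
      have "?K (- y - w r) = ?K (y + w r)" for r
        using trig_kernel_minus[of c s "y + w r"] by simp
      then have "?K (y - w r) + ?K (- y - w r) = poly (P r) x" for r
        unfolding x P(2)[symmetric] by simp
      then show ?thesis using N C by (simp add: p_def poly_sum sum_distrib_left)
    qed
    have "2 * real N * C * (f x - poly p x) = (\<Sum>r<N. (f x - f (cos (w r))) * (?K (y - w r) + ?K (- y - w r)))"
      unfolding right_diff_distrib pp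
      by (simp add: left_diff_distrib sum_subtractf sum_distrib_left[symmetric] sum.distrib K1)
    then have "2 * real N * C * \<bar>f x - poly p x\<bar> = \<bar>\<Sum>r<N. (f x - f (cos (w r))) * (?K (y - w r) + ?K (- y - w r))\<bar>"
      using N C by (metis abs_mult abs_of_pos mult_pos_pos zero_less_numeral)
    also have "\<dots> \<le> (\<Sum>r<N. \<bar>(f x - f (cos (w r))) * (?K (y - w r) + ?K (- y - w r))\<bar>)"
      by (rule sum_abs)
    also have "\<dots> \<le> (\<Sum>r<N. ?K (y - w r) * (2 * \<bar>sin ((y - w r) / 2)\<bar>) + ?K (- y - w r) * (2 * \<bar>sin ((- y - w r) / 2)\<bar>))"
    proof (rule sum_mono)
      fix r
      have "\<bar>(f x - f (cos (w r))) * (?K (y - w r) + ?K (- y - w r))\<bar>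
         = ?K (y - w r) * \<bar>f x - f (cos (w r))\<bar> + ?K (- y - w r) * \<bar>f x - f (cos (w r))\<bar>"
        unfolding abs_mult using trig_kernel_nonneg[of c s "y - w r"] trig_kernel_nonneg[of c s "- y - w r"]
        by (simp add: algebra_simps)
      also have "\<dots> \<le> ?K (y - w r) * (2 * \<bar>sin ((y - w r) / 2)\<bar>) + ?K (- y - w r) * (2 * \<bar>sin ((- y - w r) / 2)\<bar>)"
        by (intro add_mono mult_left_mono bnd trig_kernel_nonneg)
      finally show "\<bar>(f x - f (cos (w r))) * (?K (y - w r) + ?K (- y - w r))\<bar> \<le> \<dots>" .
    qed
    also have "\<dots> \<le> real N * C * d + real N * C * d"
      unfolding sum.distrib by (intro add_mono K3)
    finally have "2 * real N * C * \<bar>f x - poly p x\<bar> \<le> 2 * real N * C * d" by (simp add: mult_ac)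
    then have "\<bar>f x - poly p x\<bar> \<le> d" using N C by simp
    also have "d \<le> a" unfolding d_def using sin_x_le_x[of "a / 2"] a by simp
    finally show ?thesis by (simp add: a_def)
  qed
  ultimately show ?thesis by blast
qed

corollary jackson_interval:
  fixes f :: "real \<Rightarrow> real" and s :: nat
  assumes "a \<le> b" and lip: "\<And>x y. x \<in> {a..b} \<Longrightarrow> y \<in> {a..b} \<Longrightarrow> \<bar>f x - f y\<bar> \<le> \<bar>x - y\<bar>"
  shows "\<exists>p::real poly. degree p \<le> s \<and> (\<forall>x\<in>{a..b}. \<bar>f x - poly p x\<bar> \<le> (b - a) / 2 * pi / real (s + 2))"
proof (cases "a = b")
  case True
  then show ?thesis by (intro exI[of _ "[:f a:]"]) auto
next
  case False
  define h where "h = (b - a) / 2"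
  define m where "m = (a + b) / 2"
  have h: "h > 0" using assms False by (simp add: h_def)
  have in_ab: "m + h * y \<in> {a..b}" if "y \<in> {-1..1}" for y
  proof -
    have "h * y \<le> h * 1" "h * (-1) \<le> h * y" using that h by (intro mult_left_mono; auto)+
    then show ?thesis by (auto simp: m_def h_def field_simps)
  qed
  have "\<bar>f (m + h * x) / h - f (m + h * y) / h\<bar> \<le> \<bar>x - y\<bar>" if "x \<in> {-1..1}" "y \<in> {-1..1}" for x y
  proof -
    have "\<bar>f (m + h * x) / h - f (m + h * y) / h\<bar> = \<bar>f (m + h * x) - f (m + h * y)\<bar> / h"
      using h by (simp add: diff_divide_distrib[symmetric])
    also have "\<dots> \<le> \<bar>(m + h * x) - (m + h * y)\<bar> / h"
      using h that by (intro divide_right_mono lip in_ab) auto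
    also have "\<dots> = \<bar>h * (x - y)\<bar> / h" by (simp add: algebra_simps)
    also have "\<dots> = \<bar>x - y\<bar>" using h by (simp add: abs_mult)
    finally show ?thesis .
  qed
  from jackson_unit_interval[of "\<lambda>y. f (m + h * y) / h" s, OF this]
  obtain p :: "real poly" where p: "degree p \<le> s"
    "\<And>y. y \<in> {-1..1} \<Longrightarrow> \<bar>f (m + h * y) / h - poly p y\<bar> \<le> pi / real (s + 2)" by auto
  let ?q = "smult h (pcompose p [: - m / h, 1 / h :])"
  have "degree ?q \<le> s"
    using p(1) h by (simp add: degree_pcompose)
  moreover have "\<bar>f x - poly ?q x\<bar> \<le> (b - a) / 2 * pi / real (s + 2)" if "x \<in> {a..b}" for x
  proof -
    define y where "y = (x - m) / h"
    have x: "x = m + h * y" using h by (simp add: y_def)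
    have y: "y \<in> {-1..1}" using that h by (auto simp: y_def field_simps) (auto simp: m_def h_def field_simps)
    have "poly ?q x = h * poly p y"
      using h by (simp add: poly_pcompose y_def diff_divide_distrib)
    then have "\<bar>f x - poly ?q x\<bar> = h * \<bar>f (m + h * y) / h - poly p y\<bar>"
      using h unfolding x[symmetric] by (simp add: abs_mult_pos[symmetric] field_simps abs_mult)
    also have "\<dots> \<le> h * (pi / real (s + 2))"
      using h p(2)[OF y] by (intro mult_left_mono) auto
    finally show ?thesis by (simp add: h_def)
  qed
  ultimately show ?thesis by blast
qed

section \<open>Gaussian quadrature of discrete measures\<close>

lemma degree_prod_linear:
  "finite R \<Longrightarrow> degree (\<Prod>z\<in>R. [:- z, 1:] :: real poly) = card R"
  by (subst degree_prod_eq_sum_degree) auto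

lemma poly_prod_linear_eq_0_iff:
  "finite R \<Longrightarrow> poly (\<Prod>z\<in>R. [:- z, 1:] :: real poly) x = 0 \<longleftrightarrow> x \<in> R"
  by (auto simp: poly_prod)

text \<open>Newton's form: each new node adds a multiple of the node polynomial of the earlier ones,
  which leaves their values alone. The truncated \<open>card Z - 1\<close> also covers the empty
  set.\<close>

lemma lagrange_interpolation:
  fixes g :: "real \<Rightarrow> real"
  assumes "finite Z"
  shows "\<exists>p. degree p \<le> card Z - 1 \<and> (\<forall>z\<in>Z. poly p z = g z)"
  using assms
proof (induction Z)
  case empty
  then show ?case by (intro exI[of _ 0]) auto
next
  case (insert z Z)
  then obtain p where p: "degree p \<le> card Z - 1" "\<forall>z\<in>Z. poly p z = g z" by blast
  define q :: "real poly" where "q = (\<Prod>z\<in>Z. [:- z, 1:])"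
  have q: "degree q = card Z" "\<And>x. poly q x = 0 \<longleftrightarrow> x \<in> Z"
    unfolding q_def using insert by (simp_all add: degree_prod_linear poly_prod_linear_eq_0_iff)
  let ?r = "p + smult ((g z - poly p z) / poly q z) q"
  have "degree ?r \<le> card Z"
    using p(1) q(1) by (intro degree_add_le order.trans[OF degree_smult_le]) auto
  moreover have "\<forall>y\<in>insert z Z. poly ?r y = g y"
    using p(2) q(2) insert by (auto simp: q(2))
  ultimately show ?case using insert by (intro exI[of _ ?r]) auto
qed

lemma poly_eq_if_eq_on_points:
  fixes p q :: "real poly"
  assumes "finite Z" "degree p < card Z" "degree q < card Z" "\<And>z. z \<in> Z \<Longrightarrow> poly p z = poly q z"
  shows "p = q"
proof (rule ccontr)
  assume "p \<noteq> q"
  then have nz: "p - q \<noteq> 0" by simp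
  have "card Z \<le> card {x. poly (p - q) x = 0}"
    using assms nz by (intro card_mono poly_roots_finite) auto
  also have "\<dots> \<le> degree (p - q)" using nz by (rule card_poly_roots_bound)
  also have "\<dots> < card Z" using assms by (intro degree_diff_less) auto
  finally show False by simp
qed

text \<open>The set built here consists of the roots of odd multiplicity in the interval: each
  linear factor at \<open>z\<close> that is divided out toggles the membership of \<open>z\<close>.
  One more factor for each of them makes all multiplicities in the interval even.\<close>

lemma poly_sign_change_points:
  fixes f :: "real poly"
  assumes "f \<noteq> 0" "a \<le> b"
  shows "\<exists>R. finite R \<and> R \<subseteq> {a..b} \<and> (\<Prod>z\<in>R. [:- z, 1:]) dvd f \<and>
    ((\<forall>x\<in>{a..b}. poly (f * (\<Prod>z\<in>R. [:- z, 1:])) x \<ge> 0) \<or>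
     (\<forall>x\<in>{a..b}. poly (f * (\<Prod>z\<in>R. [:- z, 1:])) x \<le> 0))"
  using assms(1)
proof (induction "degree f" arbitrary: f rule: less_induct)
  case less
  show ?case
  proof (cases "\<exists>z\<in>{a..b}. poly f z = 0")
    case False
    have "(\<forall>x\<in>{a..b}. poly f x \<ge> 0) \<or> (\<forall>x\<in>{a..b}. poly f x \<le> 0)"
    proof (rule ccontr)
      assume "\<not> ?thesis"
      then obtain x y where xy: "x \<in> {a..b}" "y \<in> {a..b}" "poly f x < 0" "poly f y > 0"
        by (auto simp: not_le)
      have "connected (poly f ` {a..b})"
        by (intro connected_continuous_image continuous_intros) simp
      then have "0 \<in> poly f ` {a..b}"
        using xy connected_contains_Icc[of "poly f ` {a..b}" "poly f x" "poly f y"]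
        by (meson atLeastAtMost_iff image_eqI less_imp_le subset_eq)
      with False show False by auto
    qed
    then show ?thesis by (intro exI[of _ "{}"]) auto
  next
    case True
    then obtain z where z: "z \<in> {a..b}" "poly f z = 0" by blast
    then obtain g where g: "f = [:- z, 1:] * g" by (metis dvdE poly_eq_0_iff_dvd)
    have "g \<noteq> 0" using g less.prems by auto
    then have "degree f = Suc (degree g)" unfolding g by (subst degree_mult_eq) auto
    with less.hyps[of g] \<open>g \<noteq> 0\<close> obtain R where R: "finite R" "R \<subseteq> {a..b}" "(\<Prod>z\<in>R. [:- z, 1:]) dvd g"
      "(\<forall>x\<in>{a..b}. poly (g * (\<Prod>z\<in>R. [:- z, 1:])) x \<ge> 0) \<or>
       (\<forall>x\<in>{a..b}. poly (g * (\<Prod>z\<in>R. [:- z, 1:])) x \<le> 0)" by auto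
    show ?thesis
    proof (cases "z \<in> R")
      case False
      let ?R = "insert z R"
      have e: "poly (f * (\<Prod>z\<in>?R. [:- z, 1:])) x = (x - z)\<^sup>2 * poly (g * (\<Prod>z\<in>R. [:- z, 1:])) x" for x
        using False R(1) unfolding g by (simp add: power2_eq_square algebra_simps)
      have "(\<Prod>z\<in>?R. [:- z, 1:]) dvd f"
        using False R(1,3) unfolding g by (simp add: mult_dvd_mono del: mult_pCons_left)
      then show ?thesis
        using R z unfolding e
        by (intro exI[of _ ?R]) (auto simp: e zero_le_mult_iff mult_le_0_iff simp del: poly_mult)
    next
      case True
      let ?R = "R - {z}"
      have e: "(\<Prod>z\<in>R. [:- z, 1:]) = [:- z, 1:] * (\<Prod>z\<in>?R. [:- z, 1:])"
        using R(1) True by (rule prod.remove)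
      have e2: "f * (\<Prod>z\<in>?R. [:- z, 1:]) = g * (\<Prod>z\<in>R. [:- z, 1:])"
        unfolding e g by (simp only: mult_ac)
      have "(\<Prod>z\<in>?R. [:- z, 1:]) dvd g" using R(3) unfolding e by (rule dvd_mult_right)
      then have "(\<Prod>z\<in>?R. [:- z, 1:]) dvd f" unfolding g by (rule dvd_mult)
      then show ?thesis using R unfolding e2[symmetric] by (intro exI[of _ ?R]) auto
    qed
  qed
qed

section \<open>Orthogonal polynomials and Gauss rules\<close>

text \<open>Gram-Schmidt on the monomials. The bound on \<open>k\<close> keeps the form definite in
  degrees below \<open>k\<close>: a polynomial of degree below \<open>card Y\<close> that vanishes
  on \<open>Y\<close> is zero, so the divisions in \<open>c\<close> make sense.\<close>

lemma orthogonal_poly_exists: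
  fixes W :: "real \<Rightarrow> real"
  assumes Y: "finite Y" "\<And>y. y \<in> Y \<Longrightarrow> W y > 0"
  shows "k \<le> card Y \<Longrightarrow> \<exists>f::real poly. degree f = k \<and> lead_coeff f = 1 \<and>
    (\<forall>q. degree q < k \<longrightarrow> (\<Sum>y\<in>Y. W y * (poly f y * poly q y)) = 0)"
proof (induction k rule: less_induct)
  case (less k)
  let ?ip = "\<lambda>f g. \<Sum>y\<in>Y. W y * (poly f y * poly g y)"
  have ip_diff: "?ip (f - g) h = ?ip f h - ?ip g h" for f g h
    by (simp add: sum_subtractf algebra_simps)
  have ip_smult: "?ip (smult c f) h = c * ?ip f h" for c f h
    by (simp add: sum_distrib_left algebra_simps)
  have ip_sum: "?ip (\<Sum>j\<in>J. F j) h = (\<Sum>j\<in>J. ?ip (F j) h)" for F h and J :: "nat set"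
    by (simp add: poly_sum sum_distrib_left sum_distrib_right sum.swap[of _ Y J])
  have ip_commute: "?ip f h = ?ip h f" for f h by (simp add: mult.commute)
  have "\<exists>P. \<forall>j<k. degree (P j) = j \<and> lead_coeff (P j) = 1 \<and> (\<forall>q. degree q < j \<longrightarrow> ?ip (P j) q = 0)"
  proof -
    have "\<forall>j. \<exists>f::real poly. j < k \<longrightarrow> degree f = j \<and> lead_coeff f = 1 \<and> (\<forall>q. degree q < j \<longrightarrow> ?ip f q = 0)"
      using less by (meson less_imp_le_nat order.trans)
    then show ?thesis by (rule choice)
  qed
  then obtain P :: "nat \<Rightarrow> real poly" where P: "\<And>j. j < k \<Longrightarrow> degree (P j) = j"
    "\<And>j. j < k \<Longrightarrow> lead_coeff (P j) = 1" "\<And>j q. j < k \<Longrightarrow> degree q < j \<Longrightarrow> ?ip (P j) q = 0"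
    by blast
  have pos: "?ip (P j) (P j) \<noteq> 0" if "j < k" for j
  proof
    assume "?ip (P j) (P j) = 0"
    then have "\<forall>y\<in>Y. W y * (poly (P j) y * poly (P j) y) = 0"
      using Y by (subst (asm) sum_nonneg_eq_0_iff) (simp_all add: less_imp_le)
    then have "\<forall>y\<in>Y. poly (P j) y = 0" using Y by force
    then have "P j = 0"
      using P(1)[OF that] that less.prems Y by (intro poly_eq_if_eq_on_points[of Y]) auto
    then show False using P(2)[OF that] by simp
  qed
  have orth: "?ip (P i) (P j) = 0" if "i < k" "j < k" "i \<noteq> j" for i j
  proof (cases "i < j")
    case True
    then have "?ip (P j) (P i) = 0" using that P(1) by (intro P(3)) auto
    then show ?thesis unfolding ip_commute[of "P i" "P j"] .
  next
    case False
    then show ?thesis using that P(1) by (intro P(3)) auto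
  qed
  define c where "c j = ?ip (monom 1 k) (P j) / ?ip (P j) (P j)" for j
  define f where "f = monom 1 k - (\<Sum>j<k. smult (c j) (P j))"
  have lower: "degree (\<Sum>j<k. smult (c j) (P j)) < k" if "k > 0"
    using that P(1) by (intro le_less_trans[OF degree_sum_le[of _ _ "k - 1"]])
      (auto intro!: order.trans[OF degree_smult_le])
  have "degree f = k \<and> lead_coeff f = 1"
  proof (cases "k = 0")
    case False
    then have "coeff (\<Sum>j<k. smult (c j) (P j)) k = 0" using lower coeff_eq_0 by blast
    then have ck: "coeff f k = 1" by (simp add: f_def)
    have "degree f \<le> k" unfolding f_def using lower False
      by (intro degree_diff_le) (auto intro: degree_monom_le)
    moreover have "degree f \<ge> k" using ck by (intro le_degree) simp
    ultimately show ?thesis using ck by simp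
  qed (simp add: f_def monom_0)
  moreover have fP: "?ip f (P j) = 0" if "j < k" for j
  proof -
    have "?ip f (P j) = ?ip (monom 1 k) (P j) - (\<Sum>i<k. c i * ?ip (P i) (P j))"
      unfolding f_def ip_diff ip_sum ip_smult ..
    also have "(\<Sum>i<k. c i * ?ip (P i) (P j)) = (\<Sum>i<k. if i = j then c j * ?ip (P j) (P j) else 0)"
      using that orth by (intro sum.cong) auto
    also have "\<dots> = ?ip (monom 1 k) (P j)" using that pos[OF that] by (simp add: c_def)
    finally show ?thesis by simp
  qed
  \<comment> \<open>From the \<open>P j\<close> to all polynomials of degree below \<open>k\<close>,
    by cancelling the leading term with a multiple of \<open>P e\<close>; \<open>d\<close> only
    carries the induction.\<close>
  moreover have "d \<le> k \<Longrightarrow> degree q < d \<Longrightarrow> ?ip f q = 0" for d q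
  proof (induction d arbitrary: q)
    case (Suc e)
    define r where "r = q - smult (coeff q e) (P e)"
    have e: "e < k" using Suc.prems by simp
    have Pe: "coeff (P e) e = 1" using P(1,2)[OF e] by simp
    have "coeff r e = 0" by (simp add: r_def Pe)
    moreover have "degree r \<le> e" unfolding r_def using Suc.prems P(1)[OF e]
      by (intro degree_diff_le order.trans[OF degree_smult_le]) auto
    ultimately have "r = 0 \<or> degree r < e" by (metis le_neq_implies_less leading_coeff_0_iff)
    then have "?ip f r = 0" using Suc.IH[of r] e by auto
    moreover have "?ip f r = ?ip f q - coeff q e * ?ip f (P e)"
      unfolding ip_commute[of f] by (simp only: r_def ip_diff ip_smult)
    ultimately show ?case using fP[OF e] by simp
  qed simp
  ultimately show ?case by blast
qed

text \<open>The nodes are the roots of the orthogonal polynomial of degree \<open>k\<close>; the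
  sign-change argument shows that it has \<open>k\<close> distinct ones in the interval. The weights
  are the integrals of the Lagrange basis. A measure with at most \<open>k\<close> atoms is its own
  rule, hence the inequality for \<open>card R\<close>.\<close>

lemma gauss_quadrature_exists_set:
  fixes W :: "real \<Rightarrow> real"
  assumes Y: "finite Y" "\<And>y. y \<in> Y \<Longrightarrow> W y > 0" "Y \<subseteq> {a..b}" and k: "0 < k"
  shows "\<exists>R D. finite R \<and> card R \<le> k \<and> R \<subseteq> {a..b} \<and> (\<forall>z\<in>R. D z \<ge> 0) \<and>
    (\<forall>p::real poly. degree p \<le> 2 * k - 1 \<longrightarrow>
      (\<Sum>y\<in>Y. W y * poly p y) = (\<Sum>z\<in>R. D z * poly p z))"
proof (cases "card Y \<le> k")
  case True
  then show ?thesis using Y by (intro exI[of _ Y] exI[of _ W]) (auto intro: less_imp_le)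
next
  case False
  then obtain f :: "real poly" where f: "degree f = k" "lead_coeff f = 1"
    and orth: "\<And>q. degree q < k \<Longrightarrow> (\<Sum>y\<in>Y. W y * (poly f y * poly q y)) = 0"
    using orthogonal_poly_exists[of Y W k] Y by auto
  have f0: "f \<noteq> 0" using f by auto
  have "Y \<noteq> {}" using False by auto
  then have ab: "a \<le> b" using Y(3) by fastforce
  obtain R where R: "finite R" "R \<subseteq> {a..b}" "(\<Prod>z\<in>R. [:- z, 1:]) dvd f"
    and sgn: "(\<forall>x\<in>{a..b}. poly (f * (\<Prod>z\<in>R. [:- z, 1:])) x \<ge> 0) \<or>
       (\<forall>x\<in>{a..b}. poly (f * (\<Prod>z\<in>R. [:- z, 1:])) x \<le> 0)"
    using poly_sign_change_points[OF f0 ab] by blast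
  define q :: "real poly" where "q = (\<Prod>z\<in>R. [:- z, 1:])"
  have q: "degree q = card R" "\<And>x. poly q x = 0 \<longleftrightarrow> x \<in> R"
    unfolding q_def using R by (simp_all add: degree_prod_linear poly_prod_linear_eq_0_iff)
  have "card R \<le> k" using dvd_imp_degree_le[OF R(3) f0] f q(1) unfolding q_def by simp
  \<comment> \<open>With fewer than \<open>k\<close> sign changes, \<open>f * q\<close> would have fixed sign but integral zero.\<close>
  moreover have "\<not> card R < k"
  proof
    assume less: "card R < k"
    then have z: "(\<Sum>y\<in>Y. W y * poly (f * q) y) = 0" using orth[of q] q by simp
    have "\<forall>y\<in>Y. W y * poly (f * q) y = 0"
    proof (cases "\<forall>x\<in>{a..b}. poly (f * q) x \<ge> 0")
      case True
      then have "\<And>y. y \<in> Y \<Longrightarrow> W y * poly (f * q) y \<ge> 0"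
        using Y by (intro mult_nonneg_nonneg) (auto simp: less_imp_le simp del: poly_mult)
      then show ?thesis using z Y(1) by (subst (asm) sum_nonneg_eq_0_iff) (auto simp del: poly_mult)
    next
      case False
      then have "\<forall>x\<in>{a..b}. poly (f * q) x \<le> 0" using sgn by (auto simp: q_def)
      then have "\<And>y. y \<in> Y \<Longrightarrow> W y * poly (f * q) y \<le> 0"
        using Y by (intro mult_nonneg_nonpos) (auto simp: less_imp_le simp del: poly_mult)
      then show ?thesis using z Y(1) sum_nonneg_eq_0_iff[of Y "\<lambda>y. - (W y * poly (f * q) y)"]
        by (simp add: sum_negf)
    qed
    then have fq: "\<forall>y\<in>Y. poly (f * q) y = 0" using Y(2) by force
    \<comment> \<open>Off \<open>R\<close> the factor \<open>q\<close> can be cancelled; on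
      \<open>R\<close> both \<open>q\<close> and its multiple \<open>f\<close> vanish. So
      \<open>f\<close> would have more than \<open>k\<close> zeros.\<close>
    have "poly f y = 0" if "y \<in> Y" for y
    proof (cases "y \<in> R")
      case True
      then have "poly q y = 0" by (simp add: q)
      then show ?thesis using R(3) unfolding q_def by (metis dvdE mult_zero_left poly_mult)
    next
      case False
      then show ?thesis using fq that q(2) by auto
    qed
    then have "f = 0" using False f Y by (intro poly_eq_if_eq_on_points[of Y]) auto
    then show False using f0 by simp
  qed
  ultimately have cR: "card R = k" by simp
  have fR: "poly f z = 0" if "z \<in> R" for z
  proof -
    have "poly q z = 0" using that by (simp add: q)
    then show ?thesis using R(3) unfolding q_def by (metis dvdE mult_zero_left poly_mult)
  qed
  have "\<forall>z. \<exists>p. degree p \<le> k - 1 \<and> (\<forall>x\<in>R. poly p x = (if x = z then 1 else 0))"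
    using lagrange_interpolation[OF R(1), of "\<lambda>x. if x = z then 1 else 0" for z] cR by simp
  then obtain L :: "real \<Rightarrow> real poly" where L: "\<And>z. degree (L z) \<le> k - 1"
    "\<And>z x. x \<in> R \<Longrightarrow> poly (L z) x = (if x = z then 1 else 0)" by metis
  define D where "D z = (\<Sum>y\<in>Y. W y * poly (L z) y)" for z
  have low: "(\<Sum>y\<in>Y. W y * poly p y) = (\<Sum>z\<in>R. D z * poly p z)" if "degree p < k" for p :: "real poly"
  proof -
    have p: "p = (\<Sum>z\<in>R. smult (poly p z) (L z))"
    proof (rule poly_eq_if_eq_on_points[OF R(1)])
      show "degree (\<Sum>z\<in>R. smult (poly p z) (L z)) < card R"
        unfolding cR using k L(1)
        by (intro le_less_trans[OF degree_sum_le[of _ _ "k - 1"]])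
           (auto simp: R intro: order.trans[OF degree_smult_le])
      show "poly p z = poly (\<Sum>z\<in>R. smult (poly p z) (L z)) z" if "z \<in> R" for z
        using that R(1) by (simp add: poly_sum L(2) if_distrib[of "\<lambda>t. _ * t"] cong: if_cong)
    qed (use that cR in simp)
    have "(\<Sum>y\<in>Y. W y * poly p y) = (\<Sum>y\<in>Y. W y * (\<Sum>z\<in>R. poly p z * poly (L z) y))"
      by (subst p) (simp add: poly_sum)
    also have "\<dots> = (\<Sum>z\<in>R. D z * poly p z)"
      unfolding D_def sum_distrib_left sum_distrib_right
      by (subst sum.swap) (simp add: algebra_simps)
    finally show ?thesis .
  qed
  have exact: "(\<Sum>y\<in>Y. W y * poly p y) = (\<Sum>z\<in>R. D z * poly p z)"
    if "degree p \<le> 2 * k - 1" for p :: "real poly"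
  proof -
    \<comment> \<open>The quotient has degree below \<open>k\<close>, so orthogonality removes
      \<open>f * g\<close> from the left side, and the roots of \<open>f\<close> remove it from the
      right.\<close>
    define g r where "g = p div f" and "r = p mod f"
    have p: "p = f * g + r" by (simp add: g_def r_def)
    have r: "degree r < k" using degree_mod_less[OF f0, of p] f k by (auto simp: r_def)
    have "degree g < k"
    proof (cases "g = 0")
      case False
      have "k + degree g = degree (f * g)" using f False f0 by (simp add: degree_mult_eq)
      also have "f * g = p - r" using p by simp
      also have "degree (p - r) \<le> 2 * k - 1" using that r by (intro degree_diff_le) auto
      finally show ?thesis using k by simp
    qed (use k in simp)
    with r have "(\<Sum>y\<in>Y. W y * poly p y) = (\<Sum>z\<in>R. D z * poly r z)"
      using orth[of g] low[of r] by (simp add: p algebra_simps sum.distrib)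
    then show ?thesis using fR by (simp add: p)
  qed
  have "D z \<ge> 0" if "z \<in> R" for z
  proof -
    \<comment> \<open>Testing the rule on the square of a Lagrange polynomial, of degree at most
      \<open>2 * k - 2\<close>, isolates one weight.\<close>
    have "degree (L z * L z) \<le> 2 * k - 1"
      using L(1)[of z] k by (intro order.trans[OF degree_mult_le]) auto
    from exact[OF this] have "(\<Sum>y\<in>Y. W y * poly (L z * L z) y) = (\<Sum>x\<in>R. D x * poly (L z * L z) x)" .
    also have "\<dots> = (\<Sum>x\<in>R. if x = z then D z else 0)" by (intro sum.cong) (auto simp: L(2))
    also have "\<dots> = D z" using that R(1) by simp
    finally have "D z = (\<Sum>y\<in>Y. W y * poly (L z * L z) y)" ..
    also have "\<dots> \<ge> 0" using Y by (intro sum_nonneg) (simp add: less_imp_le)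
    finally show ?thesis .
  qed
  then show ?thesis using exact R cR by (intro exI[of _ R] exI[of _ D]) auto
qed

lemma gauss_quadrature_exists:
  fixes w l :: "'i::finite \<Rightarrow> real"
  assumes w: "\<And>i. w i \<ge> 0" and l: "\<And>i. l i \<in> {a..b}" and k: "0 < k"
  shows "\<exists>theta d. (\<forall>j<k. d j \<ge> 0) \<and> (\<forall>j<k. theta j \<in> {a..b}) \<and>
    (\<forall>p::real poly. degree p \<le> 2 * k - 1 \<longrightarrow>
      (\<Sum>i\<in>UNIV. w i * poly p (l i)) = (\<Sum>j<k. d j * poly p (theta j)))"
proof -
  \<comment> \<open>Zero weights are dropped and coinciding points merged, because the orthogonal
    polynomial is built from positive weights on distinct points.\<close>
  define S where "S = {i. w i > 0}"
  define Y where "Y = l ` S"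
  define W where "W y = (\<Sum>i\<in>{i \<in> S. l i = y}. w i)" for y
  have W: "W y > 0" if "y \<in> Y" for y
    unfolding W_def using that by (intro sum_pos) (auto simp: Y_def S_def)
  have sumW: "(\<Sum>i\<in>UNIV. w i * g (l i)) = (\<Sum>y\<in>Y. W y * g y)" for g
  proof -
    have "(\<Sum>i\<in>UNIV. w i * g (l i)) = (\<Sum>i\<in>S. w i * g (l i))"
      using w by (intro sum.mono_neutral_right) (auto simp: S_def not_less intro: antisym)
    also have "\<dots> = (\<Sum>y\<in>Y. \<Sum>i\<in>{i \<in> S. l i = y}. w i * g (l i))"
      unfolding Y_def by (rule sum.image_gen) simp
    also have "\<dots> = (\<Sum>y\<in>Y. W y * g y)"
      unfolding W_def sum_distrib_right by (intro sum.cong) auto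
    finally show ?thesis .
  qed
  have "finite Y" "Y \<subseteq> {a..b}" using l by (auto simp: Y_def)
  then have "\<exists>R D. finite R \<and> card R \<le> k \<and> R \<subseteq> {a..b} \<and> (\<forall>z\<in>R. D z \<ge> 0) \<and>
    (\<forall>p::real poly. degree p \<le> 2 * k - 1 \<longrightarrow>
      (\<Sum>y\<in>Y. W y * poly p y) = (\<Sum>z\<in>R. D z * poly p z))"
    using W k by (intro gauss_quadrature_exists_set)
  then obtain R D where R: "finite R" "card R \<le> k" "R \<subseteq> {a..b}" "\<forall>z\<in>R. D z \<ge> 0"
    "\<forall>p::real poly. degree p \<le> 2 * k - 1 \<longrightarrow> (\<Sum>y\<in>Y. W y * poly p y) = (\<Sum>z\<in>R. D z * poly p z)"
    by (elim exE conjE) (rule that)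
  obtain h where h: "bij_betw h {0..<card R} R" using ex_bij_betw_nat_finite[OF R(1)] by blast
  \<comment> \<open>Padding to exactly \<open>k\<close> indices, the format of \<open>GQ\<close>:
    extra nodes sit at \<open>a\<close> with weight 0.\<close>
  define theta where "theta j = (if j < card R then h j else a)" for j
  define d where "d j = (if j < card R then D (h j) else 0)" for j
  have ab: "a \<le> b" using l order.trans by fastforce
  have hR: "h j \<in> R" if "j < card R" for j using h that by (auto simp: bij_betw_def)
  have "(\<Sum>z\<in>R. D z * g z) = (\<Sum>j<k. d j * g (theta j))" for g :: "real \<Rightarrow> real"
  proof -
    have "(\<Sum>z\<in>R. D z * g z) = (\<Sum>j\<in>{0..<card R}. D (h j) * g (h j))"
      using sum.reindex_bij_betw[OF h, of "\<lambda>z. D z * g z"] by simp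
    also have "\<dots> = (\<Sum>j<k. d j * g (theta j))"
      using R(2) by (intro sum.mono_neutral_cong_left) (auto simp: d_def theta_def)
    finally show ?thesis .
  qed
  then have "\<forall>p::real poly. degree p \<le> 2 * k - 1 \<longrightarrow>
      (\<Sum>i\<in>UNIV. w i * poly p (l i)) = (\<Sum>j<k. d j * poly p (theta j))"
    using R(5) sumW by simp
  moreover have "\<forall>j<k. d j \<ge> 0" "\<forall>j<k. theta j \<in> {a..b}"
    using R(4) hR subsetD[OF R(3) hR] ab by (auto simp: d_def theta_def)
  ultimately show ?thesis by blast
qed

text \<open>Both rules together live on at most \<open>2 * k\<close> points, where any
  \<open>g\<close> agrees with a polynomial of degree at most \<open>2 * k - 1\<close>. Nodes and
  weights are not unique, since nodes can be permuted or carry weight 0, but the distribution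
  function is.\<close>

lemma quadrature_unique:
  fixes theta theta' d d' :: "nat \<Rightarrow> real"
  assumes "0 < k" and eq: "\<And>p::real poly. degree p \<le> 2 * k - 1 \<Longrightarrow>
      (\<Sum>j<k. d j * poly p (theta j)) = (\<Sum>j<k. d' j * poly p (theta' j))"
  shows "(\<Sum>j<k. d j * g (theta j)) = (\<Sum>j<k. d' j * g (theta' j))"
proof -
  define Z where "Z = theta ` {..<k} \<union> theta' ` {..<k}"
  have "card Z \<le> card (theta ` {..<k}) + card (theta' ` {..<k})" unfolding Z_def by (rule card_Un_le)
  also have "\<dots> \<le> k + k" by (intro add_mono) (metis card_image_le card_lessThan finite_lessThan)+
  finally have card: "card Z \<le> 2 * k" by simp
  have "finite Z" by (simp add: Z_def)
  then obtain p where p: "degree p \<le> card Z - 1" "\<forall>z\<in>Z. poly p z = g z"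
    using lagrange_interpolation by blast
  have "(\<Sum>j<k. d j * g (theta j)) = (\<Sum>j<k. d j * poly p (theta j))"
    "(\<Sum>j<k. d' j * g (theta' j)) = (\<Sum>j<k. d' j * poly p (theta' j))"
    using p(2) by (auto simp: Z_def intro!: sum.cong)
  then show ?thesis using eq[of p] p(1) card by simp
qed

section \<open>\<open>GQ\<close> on discrete distributions\<close>

text \<open>The measure generated by the step function is the law of \<open>l\<close> under the
  weights \<open>w\<close>, because a real distribution is determined by its
  \<open>cdf\<close>.\<close>

lemma integral_interval_measure_discrete:
  fixes w l :: "'i::finite \<Rightarrow> real" and g :: "real \<Rightarrow> real"
  assumes w: "\<And>i. w i \<ge> 0" "(\<Sum>i\<in>UNIV. w i) = 1" and [measurable]: "g \<in> borel_measurable borel"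
  shows "(\<integral>x. g x \<partial>interval_measure (\<lambda>x. \<Sum>i\<in>UNIV. w i * (if l i \<le> x then 1 else 0)))
    = (\<Sum>i\<in>UNIV. w i * g (l i))"
proof -
  define N where "N = point_measure UNIV (\<lambda>i. ennreal (w i))"
  have [measurable]: "f \<in> measurable N borel" for f :: "'i \<Rightarrow> real"
    by (simp add: N_def measurable_def space_point_measure sets_point_measure)
  define M where "M = distr N borel l"
  have emN: "emeasure N X = ennreal (\<Sum>i\<in>X. w i)" for X
    unfolding N_def using w by (subst emeasure_point_measure_finite) (auto simp: sum_ennreal)
  interpret N: prob_space N
    by (rule prob_spaceI) (simp add: emN w space_point_measure N_def[THEN arg_cong, of space])
  interpret M: real_distribution M
    unfolding M_def by (intro N.real_distribution_distr) simp
  have cdfM: "cdf M = (\<lambda>x. \<Sum>i\<in>UNIV. w i * (if l i \<le> x then 1 else 0))"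
  proof
    fix x
    have "cdf M x = measure N {i. l i \<le> x}"
      unfolding cdf_def M_def by (subst measure_distr) (auto simp: N_def space_point_measure intro!: arg_cong2[where f=measure])
    also have "\<dots> = (\<Sum>i\<in>{i. l i \<le> x}. w i)"
      using w by (simp add: measure_def emN sum_nonneg)
    also have "\<dots> = (\<Sum>i\<in>UNIV. w i * (if l i \<le> x then 1 else 0))"
      by (rule sum.mono_neutral_cong_left) auto
    finally show "cdf M x = (\<Sum>i\<in>UNIV. w i * (if l i \<le> x then 1 else 0))" .
  qed
  have "interval_measure (cdf M) = M"
  proof (rule cdf_unique)
    show "cdf (interval_measure (cdf M)) = cdf M"
      by (intro cdf_interval_measure M.cdf_nondecreasing M.cdf_is_right_cont M.cdf_lim_at_bot)
    show "real_distribution (interval_measure (cdf M))"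
      by (intro real_distribution_interval_measure M.cdf_nondecreasing M.cdf_is_right_cont M.cdf_lim_at_bot M.cdf_lim_at_top_prob)
  qed (rule M.real_distribution_axioms)
  then have "(\<integral>x. g x \<partial>interval_measure (\<lambda>x. \<Sum>i\<in>UNIV. w i * (if l i \<le> x then 1 else 0))) = (\<integral>x. g x \<partial>M)"
    by (simp add: cdfM)
  also have "\<dots> = (\<integral>i. g (l i) \<partial>N)" unfolding M_def by (subst integral_distr) auto
  also have "\<dots> = (\<Sum>i\<in>UNIV. w i * g (l i))"
    unfolding N_def using w by (subst lebesgue_integral_point_measure_finite) (auto simp: less_top[symmetric])
  finally show ?thesis .
qed

lemma borel_measurable_real_poly: "poly (p :: real poly) \<in> borel_measurable borel"
  by (intro borel_measurable_continuous_onI continuous_intros)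

text \<open>Resolves the definite description. That nodes lie in \<open>{a..b}\<close> is not
  demanded by \<open>GQ\<close>; it is inherited from the constructed rule and confines the
  quadrature error to that interval.\<close>

lemma GQ_discrete:
  fixes w l :: "'i::finite \<Rightarrow> real"
  assumes w: "\<And>i. w i \<ge> 0" "(\<Sum>i\<in>UNIV. w i) = 1" and l: "\<And>i. l i \<in> {a..b}" and k: "0 < k"
  shows "\<exists>theta d. (\<forall>j<k. d j \<ge> 0) \<and> (\<forall>j<k. theta j \<in> {a..b}) \<and>
    GQ k (\<lambda>x. \<Sum>i\<in>UNIV. w i * (if l i \<le> x then 1 else 0))
      = (\<lambda>x. \<Sum>j<k. d j * (if theta j \<le> x then 1 else 0)) \<and>
    (\<forall>p::real poly. degree p \<le> 2 * k - 1 \<longrightarrow>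
      (\<Sum>i\<in>UNIV. w i * poly p (l i)) = (\<Sum>j<k. d j * poly p (theta j)))"
proof -
  define mu where "mu = (\<lambda>x. \<Sum>i\<in>UNIV. w i * (if l i \<le> x then 1 else 0 :: real))"
  have I: "(\<integral>x. poly p x \<partial>interval_measure mu) = (\<Sum>i\<in>UNIV. w i * poly p (l i))" for p :: "real poly"
    unfolding mu_def by (intro integral_interval_measure_discrete w borel_measurable_real_poly)
  have "\<exists>theta d. (\<forall>j<k. d j \<ge> 0) \<and> (\<forall>j<k. theta j \<in> {a..b}) \<and>
    (\<forall>p::real poly. degree p \<le> 2 * k - 1 \<longrightarrow>
      (\<Sum>i\<in>UNIV. w i * poly p (l i)) = (\<Sum>j<k. d j * poly p (theta j)))"
    by (intro gauss_quadrature_exists w l k)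
  then obtain theta d where q: "\<forall>j<k. d j \<ge> 0" "\<forall>j<k. theta j \<in> {a..b}"
    "\<forall>p::real poly. degree p \<le> 2 * k - 1 \<longrightarrow>
      (\<Sum>i\<in>UNIV. w i * poly p (l i)) = (\<Sum>j<k. d j * poly p (theta j))"
    by (elim exE conjE) (rule that)
  have "GQ k mu = (\<lambda>x. \<Sum>j<k. d j * (if theta j \<le> x then 1 else 0))"
    unfolding GQ_def I
  proof (rule the_equality, goal_cases)
    case 1
    show ?case using q by (intro exI[of _ theta] exI[of _ d] conjI refl)
  next
    case (2 nu)
    then obtain theta' d' where nu: "nu = (\<lambda>x. \<Sum>j<k. d' j * (if theta' j \<le> x then 1 else 0))"
      and q': "\<forall>p::real poly. degree p \<le> 2 * k - 1 \<longrightarrow>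
        (\<Sum>i\<in>UNIV. w i * poly p (l i)) = (\<Sum>j<k. d' j * poly p (theta' j))"
      by (elim exE conjE) (rule that)
    have "(\<Sum>j<k. d' j * poly p (theta' j)) = (\<Sum>j<k. d j * poly p (theta j))"
      if "degree p \<le> 2 * k - 1" for p :: "real poly"
      using that q(3)[rule_format, of p] q'[rule_format, of p] by linarith
    from quadrature_unique[OF k this, of "\<lambda>y. if y \<le> x then 1 else 0" for x] show ?case
      unfolding nu by (intro ext)
  qed
  with q show ?thesis unfolding mu_def by (intro exI[of _ theta] exI[of _ d] conjI)
qed

section \<open>Wasserstein distance and moments\<close>

lemma emeasure_lborel_Ico_finite: "emeasure lborel {a..<b::real} < \<infinity>"
  by (rule emeasure_bounded_finite) (rule bounded_subset[of "{a..b}"], auto)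

text \<open>Since the total weight vanishes, cutting every step off at \<open>b\<close> changes
  nothing, and the cut-off steps are integrable one by one.\<close>

lemma step_sum_eq_indicator_sum:
  fixes c y :: "'i \<Rightarrow> real"
  assumes "\<And>i. i \<in> I \<Longrightarrow> y i \<le> b" "(\<Sum>i\<in>I. c i) = 0"
  shows "(\<Sum>i\<in>I. c i * (if y i \<le> x then 1 else 0)) = (\<Sum>i\<in>I. c i * indicator {y i..<b} x)"
proof -
  have "c i * indicator {y i..<b} x = c i * (if y i \<le> x then 1 else 0) - c i * (if b \<le> x then 1 else 0)"
    if "i \<in> I" for i
    using assms(1)[OF that] by (auto simp: indicator_def)
  then have "(\<Sum>i\<in>I. c i * indicator {y i..<b} x)
      = (\<Sum>i\<in>I. c i * (if y i \<le> x then 1 else 0)) - (\<Sum>i\<in>I. c i * (if b \<le> x then 1 else 0))"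
    by (simp add: sum_subtractf cong: sum.cong)
  also have "(\<Sum>i\<in>I. c i * (if b \<le> x then 1 else 0)) = 0"
    unfolding sum_distrib_right[symmetric] assms(2) by simp
  finally show ?thesis by simp
qed

lemma integrable_step_sum:
  fixes c y :: "'i \<Rightarrow> real"
  assumes "\<And>i. i \<in> I \<Longrightarrow> y i \<le> b" "(\<Sum>i\<in>I. c i) = 0"
  shows "integrable lborel (\<lambda>x. \<Sum>i\<in>I. c i * (if y i \<le> x then 1 else 0))"
proof -
  have "integrable lborel (\<lambda>x. \<Sum>i\<in>I. c i * indicator {y i..<b} x)"
    by (intro Bochner_Integration.integrable_sum integrable_mult_right integrable_real_indicator
        emeasure_lborel_Ico_finite) auto
  then show ?thesis by (simp only: step_sum_eq_indicator_sum[of I y b c, OF assms])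
qed

text \<open>Kantorovich--Rubinstein duality in the one-dimensional discrete case: the optimal
  1-Lipschitz potential is the integral \<open>F y\<close> of \<open>sgn D\<close> over \<open>[y, b)\<close>, where \<open>D\<close> is the difference of the
  distribution functions. A polynomial close to \<open>F\<close> integrates to zero.\<close>

lemma integral_abs_step_sum_le:
  fixes c y :: "'i \<Rightarrow> real"
  assumes ab: "a \<le> b" and y: "\<And>i. i \<in> I \<Longrightarrow> y i \<in> {a..b}"
    and moments: "\<And>p::real poly. degree p \<le> s \<Longrightarrow> (\<Sum>i\<in>I. c i * poly p (y i)) = 0"
  shows "(\<integral>x. \<bar>\<Sum>i\<in>I. c i * (if y i \<le> x then 1 else 0)\<bar> \<partial>lborel)
    \<le> (\<Sum>i\<in>I. \<bar>c i\<bar>) * ((b - a) / 2 * pi / real (s + 2))"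
proof -
  have c0: "(\<Sum>i\<in>I. c i) = 0" using moments[of 1] by simp
  define D where "D x = (\<Sum>i\<in>I. c i * indicator {y i..<b} x)" for x
  have [measurable]: "D \<in> borel_measurable lborel" unfolding D_def by measurable
  have intg: "integrable lborel (\<lambda>x. indicator {z..<z'} x * sgn (D x))" for z z'
    by (rule Bochner_Integration.integrable_bound[of _ "indicator {z..<z'} :: real \<Rightarrow> real"])
       (auto simp: indicator_def sgn_if intro!: integrable_real_indicator emeasure_lborel_Ico_finite)
  define F where "F z = (\<integral>x. indicator {z..<b} x * sgn (D x) \<partial>lborel)" for z
  have lip0: "\<bar>F z - F z'\<bar> \<le> \<bar>z - z'\<bar>" if "z \<le> z'" "z' \<le> b" for z z'
  proof -
    have "F z - F z' = (\<integral>x. indicator {z..<b} x * sgn (D x) - indicator {z'..<b} x * sgn (D x) \<partial>lborel)"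
      unfolding F_def by (rule Bochner_Integration.integral_diff[symmetric]) (rule intg)+
    also have "\<dots> = (\<integral>x. indicator {z..<z'} x * sgn (D x) \<partial>lborel)"
      using that by (intro Bochner_Integration.integral_cong) (auto simp: indicator_def)
    finally have "\<bar>F z - F z'\<bar> \<le> (\<integral>x. \<bar>indicator {z..<z'} x * sgn (D x)\<bar> \<partial>lborel)"
      using integral_abs_bound by simp
    also have "\<dots> \<le> (\<integral>x. indicator {z..<z'} x \<partial>lborel)"
      using that by (intro integral_mono integrable_abs intg integrable_real_indicator
          emeasure_lborel_Ico_finite) (auto simp: indicator_def sgn_if)
    also have "\<dots> = \<bar>z - z'\<bar>" using that by simp
    finally show ?thesis .
  qed
  have lip: "\<bar>F z - F z'\<bar> \<le> \<bar>z - z'\<bar>" if "z \<in> {a..b}" "z' \<in> {a..b}" for z z'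
    using lip0[of z z'] lip0[of z' z] that by (cases "z \<le> z'") (auto simp: abs_minus_commute)
  obtain p :: "real poly" where p: "degree p \<le> s"
    "\<And>x. x \<in> {a..b} \<Longrightarrow> \<bar>F x - poly p x\<bar> \<le> (b - a) / 2 * pi / real (s + 2)"
    using jackson_interval[OF ab lip, where s=s] by blast
  have "(\<integral>x. \<bar>\<Sum>i\<in>I. c i * (if y i \<le> x then 1 else 0)\<bar> \<partial>lborel) = (\<integral>x. \<bar>D x\<bar> \<partial>lborel)"
    unfolding D_def using y c0 by (subst step_sum_eq_indicator_sum[of I y b]) auto
  also have "\<dots> = (\<integral>x. (\<Sum>i\<in>I. c i * (indicator {y i..<b} x * sgn (D x))) \<partial>lborel)"
  proof (rule Bochner_Integration.integral_cong[OF refl])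
    fix x
    have "\<bar>D x\<bar> = D x * sgn (D x)" by (simp add: abs_sgn)
    also have "\<dots> = (\<Sum>i\<in>I. c i * (indicator {y i..<b} x * sgn (D x)))"
      by (subst D_def) (simp add: sum_distrib_right mult.assoc)
    finally show "\<bar>D x\<bar> = \<dots>" .
  qed
  also have "\<dots> = (\<Sum>i\<in>I. c i * F (y i))"
    unfolding F_def by (subst Bochner_Integration.integral_sum) (auto intro!: integrable_mult_right intg)
  also have "\<dots> = (\<Sum>i\<in>I. c i * (F (y i) - poly p (y i)))"
    using moments[OF p(1)] by (simp add: right_diff_distrib sum_subtractf)
  also have "\<dots> \<le> (\<Sum>i\<in>I. \<bar>c i\<bar> * ((b - a) / 2 * pi / real (s + 2)))"
  proof (rule sum_mono)
    fix i assume "i \<in> I"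
    have "c i * (F (y i) - poly p (y i)) \<le> \<bar>c i\<bar> * \<bar>F (y i) - poly p (y i)\<bar>"
      by (metis abs_ge_self abs_mult)
    also have "\<dots> \<le> \<bar>c i\<bar> * ((b - a) / 2 * pi / real (s + 2))"
      using p(2)[OF y[OF \<open>i \<in> I\<close>]] by (intro mult_left_mono) auto
    finally show "c i * (F (y i) - poly p (y i)) \<le> \<dots>" .
  qed
  finally show ?thesis by (simp only: sum_distrib_right)
qed

section \<open>Spectral decomposition of symmetric matrices\<close>

lemma symmetric_matrix_inner:
  fixes A :: "real^'n^'n"
  assumes "transpose A = A"
  shows "(A *v x) \<bullet> y = x \<bullet> (A *v y)"
  by (metis assms dot_lmul_matrix transpose_matrix_vector)

text \<open>A maximiser of the Rayleigh quotient on an invariant subspace is an eigenvector.\<close>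

lemma symmetric_eigenvector_in_invariant_subspace:
  fixes A :: "real^'n^'n"
  assumes sym: "transpose A = A" and S: "subspace S" "\<And>x. x \<in> S \<Longrightarrow> A *v x \<in> S" and "S \<noteq> {0}"
  shows "\<exists>v\<in>S. norm v = 1 \<and> (\<exists>l. A *v v = l *\<^sub>R v)"
proof -
  obtain z where z: "z \<in> S" "z \<noteq> 0" using assms subspace_0 by blast
  then have "z /\<^sub>R norm z \<in> S \<inter> sphere 0 1" using S(1) by (auto simp: subspace_scale)
  then have ne: "S \<inter> sphere 0 1 \<noteq> {}" by blast
  have "compact (S \<inter> sphere 0 1)"
    using closed_subspace[OF S(1)] compact_sphere by (metis closed_Int_compact)
  moreover have "continuous_on (S \<inter> sphere 0 1) (\<lambda>x. x \<bullet> (A *v x))"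
    by (intro continuous_intros matrix_vector_mult_linear_continuous_on)
  ultimately obtain v where v: "v \<in> S" "norm v = 1"
    and max: "\<And>x. x \<in> S \<Longrightarrow> norm x = 1 \<Longrightarrow> x \<bullet> (A *v x) \<le> v \<bullet> (A *v v)"
    using continuous_attains_sup[OF _ ne] by (metis (no_types, lifting) IntD1 IntD2 IntI mem_sphere_0)
  define l where "l = v \<bullet> (A *v v)"
  have rayleigh: "x \<bullet> (A *v x) \<le> l * (x \<bullet> x)" if "x \<in> S" for x
  proof (cases "x = 0")
    case False
    let ?y = "x /\<^sub>R norm x"
    have "?y \<bullet> (A *v ?y) \<le> l"
      unfolding l_def using that False S(1) by (intro max) (auto simp: subspace_scale)
    moreover have "?y \<bullet> (A *v ?y) = (x \<bullet> (A *v x)) / (x \<bullet> x)"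
      by (simp add: matrix_vector_mult_scaleR dot_square_norm power2_eq_square divide_inverse)
    ultimately have "(x \<bullet> (A *v x)) / (x \<bullet> x) \<le> l" by simp
    then show ?thesis using False by (simp add: divide_le_eq)
  qed (simp add: matrix_vector_mult_0_right)
  define w where "w = A *v v - l *\<^sub>R v"
  have w: "w \<in> S" unfolding w_def using v(1) S by (intro subspace_diff subspace_scale) auto
  define C where "C = l * (w \<bullet> w) - w \<bullet> (A *v w)"
  have C: "C \<ge> 0" using rayleigh[OF w] by (simp add: C_def)
  \<comment> \<open>Moving the maximiser \<open>v\<close> along its residual \<open>w\<close> would
    gain a term linear in \<open>t\<close>, proportional to \<open>w \<bullet> w\<close>, against a
    loss of order \<open>t^2\<close>.\<close>
  have ineq: "2 * t * (w \<bullet> w) \<le> t\<^sup>2 * C" for t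
  proof -
    have "v + t *\<^sub>R w \<in> S" using v(1) w S(1) by (intro subspace_add subspace_scale)
    from rayleigh[OF this]
    have "l + 2 * t * (w \<bullet> (A *v v)) + t\<^sup>2 * (w \<bullet> (A *v w)) \<le> l * (1 + 2 * t * (w \<bullet> v) + t\<^sup>2 * (w \<bullet> w))"
      using symmetric_matrix_inner[OF sym, of v w] v(2) inner_commute[of w v] inner_commute[of w "A *v v"]
        norm_eq_1[of v]
      by (simp add: matrix_vector_right_distrib matrix_vector_mult_scaleR inner_add_left inner_add_right
          power2_eq_square l_def[symmetric] algebra_simps)
    moreover have "2 * t * (w \<bullet> w) = 2 * t * (w \<bullet> (A *v v)) - 2 * t * (l * (w \<bullet> v))"
      by (subst (2) w_def) (simp add: inner_diff_right right_diff_distrib)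
    ultimately show ?thesis by (simp add: C_def algebra_simps)
  qed
  have "w \<bullet> w = 0"
  proof (rule ccontr)
    assume "w \<bullet> w \<noteq> 0"
    then have pos: "w \<bullet> w > 0" by (simp add: order_less_le)
    \<comment> \<open>Small enough for the linear term to win; the 1 covers
      \<open>C = 0\<close>.\<close>
    define t where "t = (w \<bullet> w) / (C + 1)"
    have t: "t > 0" using pos C by (simp add: t_def)
    then have "2 * (w \<bullet> w) \<le> t * C" using ineq[of t] by (simp add: power2_eq_square)
    also have "t * C \<le> w \<bullet> w" using pos C by (simp add: t_def field_simps)
    finally show False using pos by simp
  qed
  then have "A *v v = l *\<^sub>R v" by (simp add: w_def)
  with v show ?thesis by blast
qed

text \<open>Indexing by the coordinate type fixes the number of vectors at the dimension, so
  orthonormality alone yields a basis.\<close>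

definition orthonormal_frame :: "('n::finite \<Rightarrow> real^'n) \<Rightarrow> bool" where
  "orthonormal_frame u \<longleftrightarrow> (\<forall>i j. u i \<bullet> u j = (if i = j then 1 else 0))"

lemma orthonormal_frame_expand:
  fixes u :: "'n::finite \<Rightarrow> real^'n"
  assumes "orthonormal_frame u"
  shows "(\<Sum>i\<in>UNIV. (v \<bullet> u i) *\<^sub>R u i) = v"
proof -
  have u: "u i \<bullet> u j = (if i = j then 1 else 0)" for i j
    using assms by (simp add: orthonormal_frame_def)
  have "inj u" by (rule injI) (metis u zero_neq_one)
  then have card: "card (range u) = CARD('n)" by (simp add: card_image)
  have "0 \<notin> range u" using u by (metis imageE inner_zero_left zero_neq_one)
  moreover have "pairwise orthogonal (range u)"
    by (auto simp: pairwise_def orthogonal_def u)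
  ultimately have "independent (range u)" by (intro pairwise_orthogonal_independent)
  then have span: "span (range u) = UNIV"
    using card card_ge_dim_independent[of "range u" UNIV] by auto
  define w where "w = v - (\<Sum>i\<in>UNIV. (v \<bullet> u i) *\<^sub>R u i)"
  have "w \<bullet> u j = 0" for j
    by (simp add: w_def inner_diff_left inner_sum_left u if_distrib[of "\<lambda>t. _ * t"] cong: if_cong)
  then have "w \<bullet> w = 0"
    using span_induct[of w "range u" "\<lambda>x. w \<bullet> x = 0"] span
    by (auto simp: subspace_def inner_add_right)
  then show ?thesis by (simp add: w_def)
qed

lemma orthonormal_frame_inner:
  fixes u :: "'n::finite \<Rightarrow> real^'n"
  assumes "orthonormal_frame u"
  shows "x \<bullet> y = (\<Sum>i\<in>UNIV. (x \<bullet> u i) * (y \<bullet> u i))"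
proof -
  have "x \<bullet> y = (\<Sum>i\<in>UNIV. (x \<bullet> u i) *\<^sub>R u i) \<bullet> y" by (simp add: orthonormal_frame_expand[OF assms])
  then show ?thesis by (simp only: inner_sum_left inner_scaleR_left inner_commute[of y])
qed

text \<open>An orthonormal set of eigenvectors of largest size spans: symmetry makes its orthogonal
  complement invariant, and a nonzero complement would contain one more unit eigenvector.\<close>

theorem symmetric_orthonormal_eigenframe:
  fixes A :: "real^'n^'n"
  assumes sym: "transpose A = A"
  shows "\<exists>u l. orthonormal_frame u \<and> (\<forall>i. A *v u i = l i *\<^sub>R u i)"
proof -
  define P where "P B \<longleftrightarrow> pairwise orthogonal B \<and> (\<forall>b\<in>B. norm b = 1 \<and> (\<exists>l. A *v b = l *\<^sub>R b))"
    for B :: "(real^'n) set"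
  have indep: "independent B" if "P B" for B
    using that by (intro pairwise_orthogonal_independent) (auto simp: P_def)
  have bound: "finite B \<and> card B \<le> CARD('n)" if "P B" for B
    using independent_bound[OF indep[OF that]] by simp
  have "\<exists>B. P B \<and> (\<forall>B'. P B' \<longrightarrow> card B' \<le> card B)"
    using bound by (intro ex_has_greatest_nat[of P "{}" card "Suc CARD('n)"]) (auto simp: P_def less_Suc_eq_le)
  then obtain B where B: "P B" and maxB: "\<And>B'. P B' \<Longrightarrow> card B' \<le> card B" by blast
  define S where "S = {x. \<forall>b\<in>B. x \<bullet> b = 0}"
  have subS: "subspace S" by (auto simp: S_def subspace_def inner_add_left)
  have invS: "A *v x \<in> S" if "x \<in> S" for x
    using that B by (auto simp: S_def P_def symmetric_matrix_inner[OF sym])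
  have "S = {0}"
  proof (rule ccontr)
    assume "S \<noteq> {0}"
    then obtain v l where v: "v \<in> S" "norm v = 1" "A *v v = l *\<^sub>R v"
      using symmetric_eigenvector_in_invariant_subspace[OF sym subS invS] by blast
    have "v \<notin> B" using v by (auto simp: S_def)
    moreover have "P (insert v B)"
      using B v by (auto simp: P_def S_def pairwise_insert orthogonal_def inner_commute)
    ultimately show False using maxB[of "insert v B"] bound[OF B] by simp
  qed
  have "span B = UNIV"
  proof (rule ccontr)
    assume "span B \<noteq> UNIV"
    then obtain x where "x \<noteq> 0" "\<forall>b\<in>span B. x \<bullet> b = 0" using span_not_UNIV_orthogonal by blast
    then have "x \<in> S" by (auto simp: S_def span_base)
    with \<open>S = {0}\<close> \<open>x \<noteq> 0\<close> show False by auto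
  qed
  then have "card B = CARD('n)"
    using indep[OF B] dim_eq_card[of B UNIV] by (simp add: dim_UNIV)
  then obtain u :: "'n \<Rightarrow> real^'n" where u: "bij_betw u UNIV B"
    using bound[OF B] finite_same_card_bij[of "UNIV :: 'n set" B] by auto
  have uB: "u i \<in> B" for i using u by (auto simp: bij_betw_def)
  have "orthonormal_frame u"
    unfolding orthonormal_frame_def
  proof (intro allI)
    fix i j
    show "u i \<bullet> u j = (if i = j then 1 else 0)"
    proof (cases "i = j")
      case True
      then show ?thesis using B uB[of j] by (simp add: P_def dot_square_norm)
    next
      case False
      then have "u i \<noteq> u j" using u by (auto simp: bij_betw_def inj_def)
      then show ?thesis using B uB[of i] uB[of j] False by (auto simp: P_def pairwise_def orthogonal_def)
    qed
  qed
  moreover have "\<forall>i. \<exists>l. A *v u i = l *\<^sub>R u i" using B uB by (auto simp: P_def)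
  ultimately show ?thesis by metis
qed

text \<open>Compare the frame coordinates of both sides of the eigenvalue equation. This keeps
  eigenvectors of small eigenvalue free of components along frame vectors of larger
  eigenvalue.\<close>

lemma eigenframe_coefficient:
  fixes A :: "real^'n^'n"
  assumes u: "orthonormal_frame u" "\<And>i. A *v u i = l i *\<^sub>R u i" and v: "A *v v = m *\<^sub>R v"
    and nz: "v \<bullet> u i \<noteq> 0"
  shows "l i = m"
proof -
  have un: "u i \<bullet> u j = (if i = j then 1 else 0)" for i j
    using u by (simp add: orthonormal_frame_def)
  have "A *v v = A *v (\<Sum>j\<in>UNIV. (v \<bullet> u j) *\<^sub>R u j)" by (simp add: orthonormal_frame_expand[OF u(1)])
  also have "\<dots> = (\<Sum>j\<in>UNIV. (v \<bullet> u j) *\<^sub>R (l j *\<^sub>R u j))"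
    by (simp add: linear_sum[OF matrix_vector_mul_linear] matrix_vector_mult_scaleR u(2))
  finally have "(A *v v) \<bullet> u i = (v \<bullet> u i) * l i"
    by (simp add: inner_sum_left un if_distrib[of "\<lambda>t. _ * t"] cong: if_cong)
  then show ?thesis using nz v by simp
qed

lemma eigenvalues_eigenframe:
  fixes A :: "real^'n^'n"
  assumes u: "orthonormal_frame u" "\<And>i. A *v u i = l i *\<^sub>R u i"
  shows "eigenvalues A = range l"
proof -
  have "m \<in> range l" if "m \<in> eigenvalues A" for m
  proof -
    from that obtain v where v: "v \<noteq> 0" "A *v v = m *\<^sub>R v" by (auto simp: eigenvalues_def)
    then obtain i where "v \<bullet> u i \<noteq> 0"
      using orthonormal_frame_expand[OF u(1), of v] by (metis (no_types, lifting) scaleR_zero_left sum.neutral)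
    from eigenframe_coefficient[OF u v(2) this] show ?thesis by auto
  qed
  moreover have "l i \<in> eigenvalues A" for i
  proof -
    have "u i \<noteq> 0" using u(1) unfolding orthonormal_frame_def by (metis inner_zero_left zero_neq_one)
    then show ?thesis using u(2) by (auto simp: eigenvalues_def)
  qed
  ultimately show ?thesis by auto
qed

section \<open>Spectral projectors and spectral distributions in an eigenframe\<close>

lemma orth_proj_eqI:
  assumes "subspace S" "p \<in> S" "\<And>w. w \<in> S \<Longrightarrow> (v - p) \<bullet> w = 0"
  shows "orth_proj S v = p"
  unfolding orth_proj_def
proof (rule the_equality)
  fix q assume q: "q \<in> S \<and> (\<forall>w\<in>S. (v - q) \<bullet> w = 0)"
  then have d: "q - p \<in> S" using assms by (intro subspace_diff) auto
  have "(q - p) \<bullet> (q - p) = (v - p) \<bullet> (q - p) - (v - q) \<bullet> (q - p)" by (simp add: inner_diff_left)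
  also have "\<dots> = 0" using q assms(3)[OF d] d by simp
  finally show "q = p" by simp
qed (use assms in auto)

text \<open>The partial sum lies in the span of the low eigenvectors and its residual is orthogonal
  to each of them, which characterises the projection.\<close>

lemma spec_proj_eigenframe:
  fixes A :: "real^'n^'n"
  assumes u: "orthonormal_frame u" "\<And>i. A *v u i = l i *\<^sub>R u i"
  shows "spec_proj A x *v v = (\<Sum>i\<in>{i. l i \<le> x}. (v \<bullet> u i) *\<^sub>R u i)"
proof -
  have "orth_proj (span (low_eigvecs A x)) v = (\<Sum>i\<in>{i. l i \<le> x}. (v \<bullet> u i) *\<^sub>R u i)" (is "_ = ?p v") for v
  proof (rule orth_proj_eqI)
    have "u i \<noteq> 0" for i using u(1) unfolding orthonormal_frame_def by (metis inner_zero_left zero_neq_one)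
    then have "u i \<in> low_eigvecs A x" if "l i \<le> x" for i
      using that u(2) by (auto simp: low_eigvecs_def)
    then show "?p v \<in> span (low_eigvecs A x)" by (intro span_sum span_scale span_base) auto
    have "(v - ?p v) \<bullet> w = 0" if "w \<in> low_eigvecs A x" for w
    proof -
      from that obtain m where m: "m \<le> x" "A *v w = m *\<^sub>R w" by (auto simp: low_eigvecs_def)
      have "w \<bullet> u i = 0" if "\<not> l i \<le> x" for i
        using eigenframe_coefficient[OF u m(2), of i] m(1) that by auto
      then have "v \<bullet> w = (\<Sum>i\<in>{i. l i \<le> x}. (v \<bullet> u i) * (w \<bullet> u i))"
        unfolding orthonormal_frame_inner[OF u(1), of v w] by (intro sum.mono_neutral_right) auto
      then show ?thesis by (simp add: inner_diff_left inner_sum_left inner_commute[of w])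
    qed
    then show "(v - ?p v) \<bullet> w = 0" if "w \<in> span (low_eigvecs A x)" for w
      using span_induct[OF that, of "\<lambda>w. (v - ?p v) \<bullet> w = 0"]
      by (auto simp: subspace_def inner_add_right)
  qed (rule subspace_span)
  then have e: "orth_proj (span (low_eigvecs A x)) = ?p" by (rule ext)
  have "linear ?p"
    by (rule linearI) (simp_all add: inner_add_left scaleR_add_left sum.distrib scaleR_sum_right)
  then show ?thesis unfolding spec_proj_def e by (simp add: matrix_vector_mul(2))
qed

lemma wCESM_eigenframe:
  fixes A :: "real^'n^'n"
  assumes u: "orthonormal_frame u" "\<And>i. A *v u i = l i *\<^sub>R u i"
  shows "wCESM A v = (\<lambda>x. \<Sum>i\<in>UNIV. (v \<bullet> u i)\<^sup>2 * (if l i \<le> x then 1 else 0))"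
proof
  fix x
  have "wCESM A v x = (\<Sum>i\<in>{i. l i \<le> x}. (v \<bullet> u i)\<^sup>2)"
    unfolding wCESM_def spec_proj_eigenframe[OF u] by (simp add: inner_sum_right power2_eq_square)
  also have "\<dots> = (\<Sum>i\<in>UNIV. (v \<bullet> u i)\<^sup>2 * (if l i \<le> x then 1 else 0))"
    by (rule sum.mono_neutral_cong_left) auto
  finally show "wCESM A v x = \<dots>" .
qed

lemma CESM_eigenframe:
  fixes A :: "real^'n^'n"
  assumes u: "orthonormal_frame u" "\<And>i. A *v u i = l i *\<^sub>R u i"
  shows "CESM A x = real (card {i. l i \<le> x}) / real CARD('n)"
proof -
  have "trace (spec_proj A x) = (\<Sum>j\<in>UNIV. axis j 1 \<bullet> (spec_proj A x *v axis j 1))"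
    unfolding trace_def by (intro sum.cong) (simp_all add: inner_axis' matrix_vector_mult_basis column_def)
  also have "\<dots> = (\<Sum>j\<in>UNIV. \<Sum>i\<in>{i. l i \<le> x}. (u i $ j) * (u i $ j))"
    unfolding spec_proj_eigenframe[OF u] by (simp add: inner_sum_right inner_axis')
  also have "\<dots> = (\<Sum>i\<in>{i. l i \<le> x}. u i \<bullet> u i)"
    by (subst sum.swap) (simp add: inner_vec_def)
  also have "\<dots> = real (card {i. l i \<le> x})"
    using u(1) by (simp add: orthonormal_frame_def)
  finally show ?thesis by (simp add: CESM_def)
qed

section \<open>Concentration on the sphere\<close>

lemma emeasure_unit_ball:
  "emeasure lborel (ball 0 1 :: 'a::euclidean_space set) \<noteq> 0"
  "emeasure lborel (ball 0 1 :: 'a::euclidean_space set) < \<infinity>"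
  using emeasure_bounded_finite[of "ball 0 1 :: 'a set"] open_not_negligible[of "ball 0 1 :: 'a set"]
  by (auto simp: negligible_iff_null_sets null_sets_def)

lemma nn_integral_lborel_affine:
  fixes f :: "'a::euclidean_space \<Rightarrow> ennreal"
  assumes [measurable]: "f \<in> borel_measurable borel" and "c \<noteq> 0"
  shows "(\<integral>\<^sup>+x. f x \<partial>lborel) = ennreal (\<bar>c\<bar> ^ DIM('a)) * (\<integral>\<^sup>+x. f (t + c *\<^sub>R x) \<partial>lborel)"
  by (subst lborel_affine[OF assms(2), of t])
     (simp add: nn_integral_density nn_integral_distr nn_integral_cmult)

text \<open>The usual uniqueness argument for Haar measure: by Tonelli and translation invariance,
  \<open>(\<integral> f) (\<integral> g \<circ> U) = (\<integral> f \<circ> U) (\<integral> g)\<close>; the unit ball \<open>g\<close> is invariant under \<open>U\<close>.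
  (The library fact \<open>measure_linear_image\<close> is restricted to well-ordered index types.)\<close>

lemma nn_integral_lborel_isometry:
  fixes f :: "'a::euclidean_space \<Rightarrow> ennreal" and U V :: "'a \<Rightarrow> 'a"
  assumes [measurable]: "f \<in> borel_measurable borel"
    and U: "linear U" "\<And>x. norm (U x) = norm x" and UV: "\<And>x. U (V x) = x"
  shows "(\<integral>\<^sup>+x. f (U x) \<partial>lborel) = (\<integral>\<^sup>+x. f x \<partial>lborel)"
proof -
  have [measurable]: "U \<in> borel_measurable borel"
    by (intro borel_measurable_continuous_onI linear_continuous_on linear_conv_bounded_linear[THEN iffD1] U)
  define g :: "'a \<Rightarrow> ennreal" where "g = indicator (ball 0 1)"
  have [measurable]: "g \<in> borel_measurable borel" unfolding g_def by (intro borel_measurable_indicator) simp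
  have gU: "g (U y) = g y" for y using U(2)[of y] by (simp add: g_def indicator_def)
  have "(\<integral>\<^sup>+x. f x \<partial>lborel) * (\<integral>\<^sup>+y. g y \<partial>lborel) = (\<integral>\<^sup>+y. (\<integral>\<^sup>+x. f x \<partial>lborel) * g (U y) \<partial>lborel)"
    unfolding gU by (rule nn_integral_cmult[symmetric]) simp
  also have "\<dots> = (\<integral>\<^sup>+y. \<integral>\<^sup>+x. f (x + U y) * g (U y) \<partial>lborel \<partial>lborel)"
  proof (rule nn_integral_cong)
    fix y
    have "(\<integral>\<^sup>+x. f x \<partial>lborel) = (\<integral>\<^sup>+x. f (x + U y) \<partial>lborel)"
      using nn_integral_lborel_affine[of f 1 "U y"] by (simp add: add.commute)
    then show "(\<integral>\<^sup>+x. f x \<partial>lborel) * g (U y) = (\<integral>\<^sup>+x. f (x + U y) * g (U y) \<partial>lborel)"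
      by (simp add: nn_integral_multc)
  qed
  also have "\<dots> = (\<integral>\<^sup>+x. \<integral>\<^sup>+y. f (x + U y) * g (U y) \<partial>lborel \<partial>lborel)"
    by (rule lborel_pair.Fubini') measurable
  also have "\<dots> = (\<integral>\<^sup>+x. \<integral>\<^sup>+y. f (U y) * g (U y - x) \<partial>lborel \<partial>lborel)"
  proof (rule nn_integral_cong)
    fix x
    \<comment> \<open>The right inverse \<open>V\<close> pulls the shift by \<open>x\<close> back
      through \<open>U\<close>, so that it becomes a translation of \<open>y\<close>.\<close>
    have e: "U (- V x + y) = U y - x" for y
      using UV[of x] by (simp add: linear_diff[OF U(1)])
    show "(\<integral>\<^sup>+y. f (x + U y) * g (U y) \<partial>lborel) = (\<integral>\<^sup>+y. f (U y) * g (U y - x) \<partial>lborel)"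
      by (subst nn_integral_lborel_affine[of _ 1 "- V x"]) (simp_all add: e del: add_uminus_conv_diff uminus_add_conv_diff)
  qed
  also have "\<dots> = (\<integral>\<^sup>+y. \<integral>\<^sup>+x. f (U y) * g (U y - x) \<partial>lborel \<partial>lborel)"
    by (rule lborel_pair.Fubini'[symmetric]) measurable
  also have "\<dots> = (\<integral>\<^sup>+y. f (U y) * (\<integral>\<^sup>+x. g x \<partial>lborel) \<partial>lborel)"
  proof (rule nn_integral_cong)
    fix y
    have "(\<integral>\<^sup>+x. g x \<partial>lborel) = (\<integral>\<^sup>+x. g (U y - x) \<partial>lborel)"
      using nn_integral_lborel_affine[of g "-1" "U y"] by simp
    then show "(\<integral>\<^sup>+x. f (U y) * g (U y - x) \<partial>lborel) = f (U y) * (\<integral>\<^sup>+x. g x \<partial>lborel)"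
      by (simp add: nn_integral_cmult)
  qed
  also have "\<dots> = (\<integral>\<^sup>+y. f (U y) \<partial>lborel) * (\<integral>\<^sup>+x. g x \<partial>lborel)"
    by (rule nn_integral_multc) measurable
  finally have "(\<integral>\<^sup>+y. g y \<partial>lborel) * (\<integral>\<^sup>+x. f x \<partial>lborel) = (\<integral>\<^sup>+y. g y \<partial>lborel) * (\<integral>\<^sup>+y. f (U y) \<partial>lborel)"
    by (simp add: mult.commute)
  moreover have "(\<integral>\<^sup>+x. g x \<partial>lborel) = emeasure lborel (ball 0 1 :: 'a set)"
    unfolding g_def by simp
  ultimately show ?thesis using emeasure_unit_ball[where 'a='a] by (auto simp: ennreal_mult_cancel_left)
qed

text \<open>For an orthonormal frame, the squared norm of the orthogonal projection onto the span of
  the \<open>u i\<close> with \<open>i\<close> in \<open>M\<close>.\<close>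

definition partial_sq :: "('n::finite \<Rightarrow> real^'n) \<Rightarrow> 'n set \<Rightarrow> real^'n \<Rightarrow> real" where
  "partial_sq u M y = (\<Sum>i\<in>M. (y \<bullet> u i)\<^sup>2)"

lemma norm_sq_frame:
  assumes "orthonormal_frame u"
  shows "(norm y)\<^sup>2 = (\<Sum>i\<in>UNIV. (y \<bullet> u i)\<^sup>2)"
  using orthonormal_frame_inner[OF assms, of y y] by (simp add: dot_square_norm power2_eq_square)

lemma partial_sq_bounds:
  assumes "orthonormal_frame u"
  shows "0 \<le> partial_sq u M y" "partial_sq u M y \<le> (norm y)\<^sup>2"
  unfolding norm_sq_frame[OF assms] partial_sq_def by (auto intro!: sum_nonneg sum_mono2)

lemma partial_sq_scaleR: "partial_sq u M (r *\<^sub>R y) = r\<^sup>2 * partial_sq u M y"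
  by (simp add: partial_sq_def power_mult_distrib sum_distrib_left)

lemma borel_measurable_partial_sq [measurable]: "partial_sq u M \<in> borel_measurable borel"
  unfolding partial_sq_def[abs_def] by measurable

text \<open>In frame coordinates this is the unit ball stretched by \<open>1 / sqrt (1 - z)\<close>
  along the axes in \<open>M\<close>: \<open>T\<close> stretches, and \<open>U\<close> carries the
  standard axes to the frame without changing volume.\<close>

lemma emeasure_ellipsoid:
  fixes u :: "'n::finite \<Rightarrow> real^'n"
  assumes u: "orthonormal_frame u" and z: "0 \<le> z" "z < 1"
  shows "emeasure lborel {y. (norm y)\<^sup>2 - z * partial_sq u M y < 1}
    = ennreal ((1 / sqrt (1 - z)) ^ card M) * emeasure lborel (ball 0 1 :: (real^'n) set)"
proof -
  have un: "u i \<bullet> u j = (if i = j then 1 else 0)" for i j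
    using u by (simp add: orthonormal_frame_def)
  define E where "E = {y. (norm y)\<^sup>2 - z * partial_sq u M y < 1}"
  have [measurable]: "E \<in> sets borel" unfolding E_def by measurable
  define U where "U y = (\<Sum>i\<in>UNIV. (y $ i) *\<^sub>R u i)" for y :: "real^'n"
  define V :: "real^'n \<Rightarrow> real^'n" where "V x = (\<chi> i. x \<bullet> u i)" for x
  have Uu: "U y \<bullet> u j = y $ j" for y j
    by (simp add: U_def inner_sum_left un if_distrib[of "\<lambda>t. _ * t"] cong: if_cong)
  have linU: "linear U"
    unfolding U_def by (rule linearI) (simp_all add: scaleR_add_left sum.distrib scaleR_sum_right)
  have nsq: "(norm y)\<^sup>2 = (\<Sum>i\<in>UNIV. (y $ i)\<^sup>2)" for y :: "real^'n"
    using dot_square_norm[of y] by (simp add: inner_vec_def power2_eq_square)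
  have "(norm (U y))\<^sup>2 = (norm y)\<^sup>2" for y
    unfolding norm_sq_frame[OF u, of "U y"] Uu nsq[of y] ..
  then have normU: "norm (U y) = norm y" for y by (rule power2_eq_imp_eq) simp_all
  have UV: "U (V x) = x" for x
    using orthonormal_frame_expand[OF u, of x] by (simp add: U_def V_def)
  have [measurable]: "U \<in> borel_measurable borel"
    by (intro borel_measurable_continuous_onI linear_continuous_on linear_conv_bounded_linear[THEN iffD1] linU)
  define c where "c j = (if axis_index j \<in> M then 1 / sqrt (1 - z) else 1)" for j :: "real^'n"
  have c: "c j > 0" for j using z by (simp add: c_def)
  define T where "T x = 0 + (\<Sum>j\<in>Basis. (c j * (x \<bullet> j)) *\<^sub>R j)" for x :: "real^'n"
  have [measurable]: "T \<in> borel_measurable borel" unfolding T_def by measurable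
  have Basis_eq: "Basis = range (\<lambda>i. axis i 1 :: real^'n)" by (auto simp: Basis_vec_def)
  have inj: "inj (\<lambda>i. axis i 1 :: real^'n)" by (auto simp: inj_def axis_eq_axis)
  have Ti: "T x $ i = c (axis i 1) * x $ i" for x i
  proof -
    have "T x \<bullet> axis i 1 = c (axis i 1) * (x \<bullet> axis i 1)"
      unfolding T_def by (simp add: inner_sum_left_Basis axis_in_Basis_iff)
    then show ?thesis by (simp add: inner_axis)
  qed
  have TE: "U (T x) \<in> E \<longleftrightarrow> x \<in> ball 0 1" for x
  proof -
    have "(norm (U (T x)))\<^sup>2 - z * partial_sq u M (U (T x))
      = (\<Sum>i\<in>UNIV. (T x $ i)\<^sup>2 - (if i \<in> M then z * (T x $ i)\<^sup>2 else 0))"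
      by (simp add: normU nsq partial_sq_def Uu sum_subtractf sum_distrib_left sum.If_cases)
    also have "\<dots> = (\<Sum>i\<in>UNIV. (x $ i)\<^sup>2)"
      using z by (intro sum.cong) (auto simp: Ti c_def power_mult_distrib power_divide field_simps)
    also have "\<dots> = (norm x)\<^sup>2" by (rule nsq[symmetric])
    finally show ?thesis by (simp add: E_def power_less_one_iff)
  qed
  have prodc: "(\<Prod>j\<in>Basis. \<bar>c j\<bar>) = (1 / sqrt (1 - z)) ^ card M"
  proof -
    have "(\<Prod>j\<in>Basis. \<bar>c j\<bar>) = (\<Prod>i\<in>UNIV. if i \<in> M then 1 / sqrt (1 - z) else 1)"
      unfolding Basis_eq prod.reindex[OF inj] using z by (intro prod.cong) (auto simp: c_def)
    then show ?thesis by (simp add: prod.If_cases)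
  qed
  have "emeasure lborel E = (\<integral>\<^sup>+x. indicator E x \<partial>lborel)" by simp
  also have "\<dots> = (\<integral>\<^sup>+x. indicator E (U x) \<partial>lborel)"
    using linU normU UV by (intro nn_integral_lborel_isometry[symmetric]) auto
  also have "\<dots> = (\<integral>\<^sup>+x. indicator E (U x) \<partial>density (distr lborel borel T) (\<lambda>_. \<Prod>j\<in>Basis. ennreal \<bar>c j\<bar>))"
    unfolding T_def using less_imp_neq[OF c] by (subst lborel_affine_euclidean[of c 0]) (auto simp: prod_ennreal)
  also have "\<dots> = ennreal (\<Prod>j\<in>Basis. \<bar>c j\<bar>) * (\<integral>\<^sup>+x. indicator E (U (T x)) \<partial>lborel)"
    by (simp add: nn_integral_density nn_integral_distr nn_integral_cmult prod_ennreal)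
  also have "(\<integral>\<^sup>+x. indicator E (U (T x)) \<partial>lborel) = (\<integral>\<^sup>+x. indicator (ball 0 1 :: (real^'n) set) x \<partial>lborel)"
    by (intro nn_integral_cong) (simp only: indicator_def TE)
  finally show ?thesis by (simp add: E_def prodc)
qed

text \<open>Both sides are \<open>\<integral>\<integral> n |x|^n / r^(n+1)\<close> over
  \<open>q x < 1\<close>, \<open>|x| < r\<close>, integrated in either order after substituting \<open>x = r y\<close>.\<close>

lemma emeasure_star_body:
  fixes q :: "real^'n \<Rightarrow> real"
  assumes [measurable]: "q \<in> borel_measurable borel"
    and hom: "\<And>r y. q (r *\<^sub>R y) = r\<^sup>2 * q y" and pos: "\<And>y. y \<noteq> 0 \<Longrightarrow> q y > 0"
  shows "emeasure lborel {y. q y < 1}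
    = (\<integral>\<^sup>+y. ennreal ((norm y / sqrt (q y)) ^ CARD('n)) * indicator (ball 0 1) y \<partial>lborel)"
proof -
  define n where "n = CARD('n)"
  have n: "n > 0" by (simp add: n_def)
  define G where "G r x = (if 0 < r \<and> q x < 1 \<and> norm x < r then real n * norm x ^ n / r ^ (n + 1) else 0)"
    for r :: real and x :: "real^'n"
  have [measurable]: "case_prod G \<in> borel_measurable (borel \<Otimes>\<^sub>M borel)"
    unfolding G_def[abs_def] case_prod_beta' by measurable
  have Gm: "(\<lambda>(r, x). ennreal (G r x)) \<in> borel_measurable (lborel \<Otimes>\<^sub>M lborel)"
    by measurable
  \<comment> \<open>At \<open>x = 0\<close> the inner integral of \<open>G\<close> is 0, yet the
    indicator it is compared with is 1, as \<open>q 0 = 0\<close>.\<close>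
  have AE0: "AE x in lborel. x \<noteq> (0 :: real^'n)" by (rule AE_lborel_singleton)
  have "(\<integral>\<^sup>+r. \<integral>\<^sup>+x. ennreal (G r x) \<partial>lborel \<partial>lborel) = (\<integral>\<^sup>+x. \<integral>\<^sup>+r. ennreal (G r x) \<partial>lborel \<partial>lborel)"
    using Gm by (rule lborel_pair.Fubini'[symmetric])
  also have "\<dots> = (\<integral>\<^sup>+x. indicator {y. q y < 1} x \<partial>lborel)"
  proof (rule nn_integral_cong_AE, use AE0 in eventually_elim)
    fix x :: "real^'n" assume x: "x \<noteq> 0"
    define a where "a = norm x"
    have a: "a > 0" using x by (simp add: a_def)
    have "(\<integral>\<^sup>+r. ennreal (G r x) \<partial>lborel)
      = (\<integral>\<^sup>+r. ennreal (real n * a ^ n / r ^ (n + 1)) * indicator {a..} r * indicator {y. q y < 1} x \<partial>lborel)"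
    proof (rule nn_integral_cong_AE)
      show "AE r in lborel. ennreal (G r x)
          = ennreal (real n * a ^ n / r ^ (n + 1)) * indicator {a..} r * indicator {y. q y < 1} x"
        using AE_lborel_singleton[of a] by eventually_elim (use a in \<open>auto simp: G_def a_def[symmetric] indicator_def\<close>)
    qed
    also have "\<dots> = (\<integral>\<^sup>+r. ennreal (real n * a ^ n / r ^ (n + 1)) * indicator {a..} r \<partial>lborel) * indicator {y. q y < 1} x"
      by (rule nn_integral_multc) measurable
    also have "(\<integral>\<^sup>+r. ennreal (real n * a ^ n / r ^ (n + 1)) * indicator {a..} r \<partial>lborel)
      = ennreal (0 - (- (a ^ n / a ^ n)))"
    proof (rule nn_integral_FTC_atLeast[where F="\<lambda>r. - (a ^ n / r ^ n)"])
      show "DERIV (\<lambda>r. - (a ^ n / r ^ n)) r :> real n * a ^ n / r ^ (n + 1)" if "a \<le> r" for r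
      proof -
        have r: "r > 0" using that a by simp
        have "r ^ (n - 1) * r = r ^ n" using n by (metis power_minus_mult)
        then show ?thesis using r
          by (auto intro!: derivative_eq_intros simp: field_simps power2_eq_square)
      qed
      show "0 \<le> real n * a ^ n / r ^ (n + 1)" if "a \<le> r" for r using that a by simp
      have "filterlim (\<lambda>r::real. r ^ n) at_top at_top" using n by (intro filterlim_pow_at_top filterlim_ident)
      then have "((\<lambda>r. a ^ n / r ^ n) \<longlongrightarrow> 0) at_top"
        by (intro real_tendsto_divide_at_top[OF tendsto_const])
      then show "((\<lambda>r. - (a ^ n / r ^ n)) \<longlongrightarrow> 0) at_top" using tendsto_minus by fastforce
    qed measurable
    also have "\<dots> = 1" using a by simp
    finally show "(\<integral>\<^sup>+r. ennreal (G r x) \<partial>lborel) = indicator {y. q y < 1} x" by simp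
  qed
  also have "\<dots> = emeasure lborel {y. q y < 1}" by (rule nn_integral_indicator) measurable
  finally have left: "(\<integral>\<^sup>+r. \<integral>\<^sup>+x. ennreal (G r x) \<partial>lborel \<partial>lborel) = emeasure lborel {y. q y < 1}" .
  \<comment> \<open>\<open>G r (r *\<^sub>R y)\<close> multiplied by the Jacobian
    \<open>r ^ n\<close>.\<close>
  define H where "H r y = (if 0 < r \<and> r\<^sup>2 * q y < 1 \<and> norm y < 1 then real n * norm y ^ n * r ^ (n - 1) else 0)"
    for r :: real and y :: "real^'n"
  have [measurable]: "case_prod H \<in> borel_measurable (borel \<Otimes>\<^sub>M borel)"
    unfolding H_def[abs_def] case_prod_beta' by measurable
  have Hm: "(\<lambda>(r, x). ennreal (H r x)) \<in> borel_measurable (lborel \<Otimes>\<^sub>M lborel)"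
    by measurable
  have scale: "(\<integral>\<^sup>+x. ennreal (G r x) \<partial>lborel) = (\<integral>\<^sup>+y. ennreal (H r y) \<partial>lborel)" for r
  proof (cases "r > 0")
    case True
    have Gr [measurable]: "(\<lambda>x. ennreal (G r x)) \<in> borel_measurable borel"
      unfolding G_def by measurable
    have "(\<integral>\<^sup>+x. ennreal (G r x) \<partial>lborel)
        = (\<integral>\<^sup>+y. ennreal (\<bar>r\<bar> ^ DIM(real^'n)) * ennreal (G r (r *\<^sub>R y)) \<partial>lborel)"
      using True by (subst nn_integral_lborel_affine[OF Gr, of r 0]) (simp_all add: nn_integral_cmult)
    also have "\<dots> = (\<integral>\<^sup>+y. ennreal (H r y) \<partial>lborel)"
    proof (rule nn_integral_cong)
      fix y :: "real^'n"
      have "r ^ n * G r (r *\<^sub>R y) = H r y"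
      proof -
        have "r ^ n = r * r ^ (n - 1)" using n by (metis mult.commute power_minus_mult)
        then show ?thesis using True
          by (simp add: G_def H_def hom power_mult_distrib field_simps)
      qed
      moreover have "0 \<le> G r (r *\<^sub>R y)" using True by (simp add: G_def)
      ultimately show "ennreal (\<bar>r\<bar> ^ DIM(real^'n)) * ennreal (G r (r *\<^sub>R y)) = ennreal (H r y)"
        using True by (simp add: ennreal_mult[symmetric] n_def)
    qed
    finally show ?thesis .
  qed (simp add: G_def H_def)
  have "(\<integral>\<^sup>+r. \<integral>\<^sup>+x. ennreal (G r x) \<partial>lborel \<partial>lborel) = (\<integral>\<^sup>+y. \<integral>\<^sup>+r. ennreal (H r y) \<partial>lborel \<partial>lborel)"
    unfolding scale using Hm by (rule lborel_pair.Fubini'[symmetric])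
  also have "\<dots> = (\<integral>\<^sup>+y. ennreal ((norm y / sqrt (q y)) ^ n) * indicator (ball 0 1) y \<partial>lborel)"
  proof (rule nn_integral_cong_AE, use AE0 in eventually_elim)
    fix y :: "real^'n" assume y: "y \<noteq> 0"
    define R where "R = 1 / sqrt (q y)"
    have R: "R > 0" using pos[OF y] by (simp add: R_def)
    have RR: "r\<^sup>2 * q y < 1 \<longleftrightarrow> r < R" if "r > 0" for r
    proof -
      have "r\<^sup>2 * q y < 1 \<longleftrightarrow> (r * sqrt (q y))\<^sup>2 < 1\<^sup>2" using pos[OF y] by (simp add: power_mult_distrib)
      also have "\<dots> \<longleftrightarrow> r * sqrt (q y) < 1" using that pos[OF y]
        by (simp add: power_less_one_iff del: real_sqrt_pow2 power_mult_distrib)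
      also have "\<dots> \<longleftrightarrow> r < R" using pos[OF y] by (simp add: R_def field_simps)
      finally show ?thesis .
    qed
    have "(\<integral>\<^sup>+r. ennreal (H r y) \<partial>lborel)
      = (\<integral>\<^sup>+r. ennreal (real n * norm y ^ n * r ^ (n - 1)) * indicator {0..R} r * indicator (ball 0 1) y \<partial>lborel)"
    proof (rule nn_integral_cong_AE)
      show "AE r in lborel. ennreal (H r y)
          = ennreal (real n * norm y ^ n * r ^ (n - 1)) * indicator {0..R} r * indicator (ball 0 1) y"
        using AE_lborel_singleton[of 0] AE_lborel_singleton[of R]
        by eventually_elim (auto simp: H_def indicator_def RR)
    qed
    also have "\<dots> = (\<integral>\<^sup>+r. ennreal (real n * norm y ^ n * r ^ (n - 1)) * indicator {0..R} r \<partial>lborel) * indicator (ball 0 1) y"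
      by (rule nn_integral_multc) measurable
    also have "(\<integral>\<^sup>+r. ennreal (real n * norm y ^ n * r ^ (n - 1)) * indicator {0..R} r \<partial>lborel)
      = ennreal (norm y ^ n * R ^ n - norm y ^ n * 0 ^ n)"
      by (rule nn_integral_FTC_Icc[where F="\<lambda>r. norm y ^ n * r ^ n"]) (use R in \<open>auto intro!: derivative_eq_intros\<close>)
    also have "\<dots> = ennreal ((norm y / sqrt (q y)) ^ n)"
      using n by (simp add: R_def power_divide zero_power)
    finally show "(\<integral>\<^sup>+r. ennreal (H r y) \<partial>lborel) = ennreal ((norm y / sqrt (q y)) ^ n) * indicator (ball 0 1) y" .
  qed
  finally show ?thesis unfolding left n_def .
qed

section \<open>The projected fraction of a uniform unit vector\<close>

text \<open>The quotient is invariant under the radial projection that defines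
  \<open>sphere_unif\<close>. For an orthonormal frame it lies in [0, 1] at every vector, including
  the origin where it is 0 by convention, so bounds need no almost-everywhere clause.\<close>

definition sq_fraction :: "('n::finite \<Rightarrow> real^'n) \<Rightarrow> 'n set \<Rightarrow> real^'n \<Rightarrow> real" where
  "sq_fraction u M v = partial_sq u M v / (norm v)\<^sup>2"

lemma sq_fraction_bounds:
  assumes "orthonormal_frame u"
  shows "0 \<le> sq_fraction u M v" "sq_fraction u M v \<le> 1"
  using partial_sq_bounds[OF assms, of M v] by (auto simp: sq_fraction_def divide_le_eq_1)

lemma sq_fraction_scaleR: "r \<noteq> 0 \<Longrightarrow> sq_fraction u M (r *\<^sub>R v) = sq_fraction u M v"
  by (simp add: sq_fraction_def partial_sq_scaleR power_mult_distrib)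

lemma borel_measurable_sq_fraction [measurable]: "sq_fraction u M \<in> borel_measurable borel"
  unfolding sq_fraction_def[abs_def] by measurable

lemma sets_sphere_unif [measurable_cong, simp]: "sets sphere_unif = sets borel"
  by (simp add: sphere_unif_def)

lemma space_sphere_unif [simp]: "space sphere_unif = UNIV"
  by (simp add: sphere_unif_def)

lemma prob_space_sphere_unif: "prob_space (sphere_unif :: (real^'n) measure)"
proof -
  interpret prob_space "uniform_measure lborel (ball 0 1 :: (real^'n) set)"
    using emeasure_unit_ball by (intro prob_space_uniform_measure) (auto simp: less_top)
  show ?thesis unfolding sphere_unif_def by (rule prob_space_distr) measurable
qed

lemma AE_sphere_unif_norm: "AE v in (sphere_unif :: (real^'n) measure). norm v = 1"
proof -
  have "AE x in uniform_measure lborel (ball 0 1 :: (real^'n) set). norm (x /\<^sub>R norm x) = 1"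
  proof (rule AE_uniform_measureI)
    show "AE x in lborel. x \<in> (ball 0 1 :: (real^'n) set) \<longrightarrow> norm (x /\<^sub>R norm x) = 1"
      by (rule eventually_mono[OF AE_lborel_singleton[of "0 :: real^'n"]]) simp
  qed simp
  then show ?thesis unfolding sphere_unif_def by (subst AE_distr_iff) measurable
qed

text \<open>This takes the place of a moment generating function. At \<open>y / |y|\<close> the
  integrand is the \<open>n\<close>-th power of the radial function of the ellipsoid
  \<open>q < 1\<close>, so its mean is the ratio of the volumes of ellipsoid and ball.\<close>

lemma nn_integral_sphere_unif_sq_fraction:
  fixes u :: "'n::finite \<Rightarrow> real^'n"
  assumes u: "orthonormal_frame u" and z: "0 \<le> z" "z < 1"
  shows "(\<integral>\<^sup>+v. ennreal ((1 / sqrt (1 - z * sq_fraction u M v)) ^ CARD('n)) \<partial>sphere_unif)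
    = ennreal ((1 / sqrt (1 - z)) ^ card M)"
proof -
  define q where "q y = (norm y)\<^sup>2 - z * partial_sq u M y" for y :: "real^'n"
  have [measurable]: "q \<in> borel_measurable borel" unfolding q_def by measurable
  have hom: "q (r *\<^sub>R y) = r\<^sup>2 * q y" for r y
    by (simp add: q_def partial_sq_scaleR power_mult_distrib algebra_simps)
  have pos: "q y > 0" if "y \<noteq> 0" for y
  proof -
    have "z * partial_sq u M y \<le> z * (norm y)\<^sup>2"
      using z partial_sq_bounds[OF u] by (intro mult_left_mono) auto
    also have "\<dots> < 1 * (norm y)\<^sup>2" using z that by (intro mult_strict_right_mono) auto
    finally show ?thesis by (simp add: q_def)
  qed
  let ?h = "\<lambda>v. (1 / sqrt (1 - z * sq_fraction u M v)) ^ CARD('n)"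
  let ?B = "ball 0 1 :: (real^'n) set"
  have eq: "?h (y /\<^sub>R norm y) = (norm y / sqrt (q y)) ^ CARD('n)" if "y \<noteq> 0" for y
  proof -
    have "1 - z * sq_fraction u M y = q y / (norm y)\<^sup>2"
      using that by (simp add: q_def sq_fraction_def field_simps)
    then show ?thesis using that by (simp add: sq_fraction_scaleR real_sqrt_divide)
  qed
  have "(\<integral>\<^sup>+v. ennreal (?h v) \<partial>sphere_unif) = (\<integral>\<^sup>+y. ennreal (?h (y /\<^sub>R norm y)) \<partial>uniform_measure lborel ?B)"
    unfolding sphere_unif_def by (subst nn_integral_distr) measurable
  also have "\<dots> = (\<integral>\<^sup>+y. ennreal (?h (y /\<^sub>R norm y)) * indicator ?B y \<partial>lborel) / emeasure lborel ?B"
    by (rule nn_integral_uniform_measure) measurable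
  also have "(\<integral>\<^sup>+y. ennreal (?h (y /\<^sub>R norm y)) * indicator ?B y \<partial>lborel)
      = (\<integral>\<^sup>+y. ennreal ((norm y / sqrt (q y)) ^ CARD('n)) * indicator ?B y \<partial>lborel)"
    using AE_lborel_singleton[of "0 :: real^'n"]
    by (intro nn_integral_cong_AE) (auto simp: eq elim!: eventually_mono)
  also have "\<dots> = emeasure lborel {y. q y < 1}"
    by (rule emeasure_star_body[symmetric]) (use hom pos in auto)
  also have "\<dots> = ennreal ((1 / sqrt (1 - z)) ^ card M) * emeasure lborel ?B"
    unfolding q_def by (rule emeasure_ellipsoid[OF u z])
  also have "\<dots> / emeasure lborel ?B = ennreal ((1 / sqrt (1 - z)) ^ card M)"
    using emeasure_unit_ball by (intro ennreal_mult_divide_eq) (auto simp: less_top)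
  finally show ?thesis .
qed

text \<open>With \<open>p\<close> fixed, the difference of the sides vanishes at
  \<open>x = p\<close> and has derivative \<open>(x - p) * (1 / (x * (1 - x)) - 4)\<close>,
  nonnegative to the right of \<open>p\<close> because \<open>x * (1 - x)\<close> is at most
  1/4.\<close>

lemma bernoulli_pinsker:
  fixes p q :: real
  assumes p: "0 < p" and pq: "p \<le> q" and q: "q < 1"
  shows "2 * (q - p)\<^sup>2 \<le> p * ln (p / q) + (1 - p) * ln ((1 - p) / (1 - q))"
proof -
  define f where "f x = p * (ln p - ln x) + (1 - p) * (ln (1 - p) - ln (1 - x)) - 2 * (x - p)\<^sup>2" for x
  have "f p \<le> f q"
  proof (rule DERIV_nonneg_imp_nondecreasing[OF pq])
    fix x assume x: "p \<le> x" "x \<le> q"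
    have x01: "0 < x" "x < 1" using x p q by auto
    have "(f has_real_derivative - p / x + (1 - p) / (1 - x) - 4 * (x - p)) (at x)"
      unfolding f_def using x01 by (auto intro!: derivative_eq_intros simp: divide_inverse algebra_simps)
    moreover have "- p / x + (1 - p) / (1 - x) - 4 * (x - p) = (x - p) * (1 / (x * (1 - x)) - 4)"
      using x01 by (simp add: field_simps)
    moreover have "(x - p) * (1 / (x * (1 - x)) - 4) \<ge> 0"
    proof -
      have "4 * (x * (1 - x)) \<le> 1" using sum_squares_ge_zero[of "2 * x - 1" 0] by (simp add: algebra_simps)
      moreover have "x * (1 - x) > 0" using x01 by simp
      ultimately have "4 \<le> 1 / (x * (1 - x))" by (simp add: pos_le_divide_eq)
      then show ?thesis using x by simp
    qed
    ultimately show "\<exists>y. (f has_real_derivative y) (at x) \<and> 0 \<le> y" by auto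
  qed
  moreover have "f p = 0" by (simp add: f_def)
  moreover have "f q = p * ln (p / q) + (1 - p) * ln ((1 - p) / (1 - q)) - 2 * (q - p)\<^sup>2"
    using assms by (simp add: f_def ln_div)
  ultimately show ?thesis by simp
qed

text \<open>Exponential tilting by \<open>z\<close>; the choice of \<open>z\<close> makes the exponent the relative entropy
  of Bernoulli(\<open>p\<close>) with respect to Bernoulli(\<open>q\<close>), to which Pinsker's inequality applies.\<close>

theorem sphere_sq_fraction_upper_tail:
  fixes u :: "'n::finite \<Rightarrow> real^'n" and M :: "'n set" and nv :: nat and r :: real
  assumes u: "orthonormal_frame u" and M: "M \<noteq> {}" "M \<noteq> UNIV" and r: "r > 0"
  defines "P \<equiv> PiM {..<nv} (\<lambda>_. sphere_unif :: (real^'n) measure)"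
  shows "measure P {vs \<in> space P. (\<Sum>i<nv. sq_fraction u M (vs i)) > real nv * (real (card M) / real CARD('n) + r)}
    \<le> exp (- (real CARD('n) * real nv * r\<^sup>2))"
proof -
  define n where "n = CARD('n)"
  define p where "p = real (card M) / real n"
  define q where "q = p + r"
  define A where "A = {vs \<in> space P. (\<Sum>i<nv. sq_fraction u M (vs i)) > real nv * q}"
  have n: "n > 0" by (simp add: n_def)
  have cM: "0 < card M" "card M < n"
    using M by (auto simp: n_def card_gt_0_iff intro!: psubset_card_mono)
  have p: "0 < p" "p < 1" using cM by (auto simp: p_def)
  interpret S: prob_space "sphere_unif :: (real^'n) measure" by (rule prob_space_sphere_unif)
  interpret PS: product_sigma_finite "\<lambda>_::nat. sphere_unif :: (real^'n) measure" ..
  have Am: "A \<in> sets P" unfolding A_def P_def by measurable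
  show ?thesis
  proof (cases "q < 1")
    case False
    have "(\<Sum>i<nv. sq_fraction u M (vs i)) \<le> real nv * q" for vs
    proof -
      have "(\<Sum>i<nv. sq_fraction u M (vs i)) \<le> (\<Sum>i<nv. 1)"
        by (intro sum_mono sq_fraction_bounds u)
      also have "\<dots> \<le> real nv * q" using False mult_left_mono[of 1 q "real nv"] by simp
      finally show ?thesis .
    qed
    then have "A = {}" by (auto simp: A_def not_less)
    then have "measure P A \<le> exp (- (real n * real nv * r\<^sup>2))" by simp
    then show ?thesis unfolding A_def q_def p_def n_def .
  next
    case True
    have q: "0 < q" "q < 1" "p < q" using p r True by (auto simp: q_def)
    \<comment> \<open>The stationary point of \<open>ln (1 - z * q) - p * ln (1 - z)\<close>, which
      times \<open>n / 2\<close> is the logarithm of \<open>K\<close> below.\<close>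
    define z where "z = (q - p) / (q * (1 - p))"
    have z1: "1 - z = p * (1 - q) / (q * (1 - p))" and z2: "1 - z * q = (1 - q) / (1 - p)"
      using p q by (simp_all add: z_def field_simps)
    have z: "0 < z" "z < 1" "1 - z * q > 0"
    proof -
      show "0 < z" using p q by (simp add: z_def)
      have "1 - z > 0" unfolding z1 using p q by simp
      then show "z < 1" by simp
      show "1 - z * q > 0" unfolding z2 using p q by simp
    qed
    have zX: "1 - z * sq_fraction u M v > 0" for v
    proof -
      have "z * sq_fraction u M v \<le> z * 1" using z by (intro mult_left_mono sq_fraction_bounds u) auto
      also have "\<dots> < 1" using z by simp
      finally show ?thesis by simp
    qed
    define W where "W v = (sqrt (1 - z * q) / sqrt (1 - z * sq_fraction u M v)) ^ n" for v
    have [measurable]: "W \<in> borel_measurable borel" unfolding W_def by measurable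
    have W0: "W v \<ge> 0" for v using z zX[of v] by (simp add: W_def)
    define s where "s = real n / 2 * (z / (1 - z * q))"
    have s: "s > 0" using n z by (simp add: s_def)
    \<comment> \<open>\<open>ln (W v)\<close> is a convex function of the fraction \<open>X\<close>
      that vanishes at \<open>X = q\<close>; its tangent there has slope \<open>s\<close>. The
      exponential of the tangent multiplies over samples into a function of the sum of
      fractions.\<close>
    have W: "exp (s * (sq_fraction u M v - q)) \<le> W v" for v
    proof -
      define X where "X = sq_fraction u M v"
      have X: "1 - z * X > 0" using zX by (simp add: X_def)
      have "ln ((1 - z * X) / (1 - z * q)) \<le> (1 - z * X) / (1 - z * q) - 1"
        using X z by (intro ln_le_minus_one) simp
      also have "\<dots> = - (z / (1 - z * q)) * (X - q)" using z by (simp add: field_simps)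
      finally have "s * (X - q) \<le> real n / 2 * (ln (1 - z * q) - ln (1 - z * X))"
        using n X z mult_left_mono[of "ln ((1 - z * X) / (1 - z * q))" "- (z / (1 - z * q)) * (X - q)" "real n / 2"]
        by (simp add: s_def ln_div right_diff_distrib)
      also have "\<dots> = real n * ln (sqrt (1 - z * q) / sqrt (1 - z * X))"
        using X z by (simp add: ln_div ln_sqrt field_simps)
      finally have "exp (s * (X - q)) \<le> exp (real n * ln (sqrt (1 - z * q) / sqrt (1 - z * X)))" by simp
      also have "\<dots> = W v" using X z by (simp add: W_def X_def[symmetric] exp_of_nat_mult)
      finally show ?thesis by (simp add: X_def)
    qed
    define K where "K = sqrt (1 - z * q) ^ n * (1 / sqrt (1 - z)) ^ card M"
    have K0: "K \<ge> 0" using z by (simp add: K_def)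
    have intW: "(\<integral>\<^sup>+v. ennreal (W v) \<partial>sphere_unif) = ennreal K"
    proof -
      have "(\<integral>\<^sup>+v. ennreal (W v) \<partial>sphere_unif)
        = (\<integral>\<^sup>+v. ennreal (sqrt (1 - z * q) ^ n) * ennreal ((1 / sqrt (1 - z * sq_fraction u M v)) ^ CARD('n)) \<partial>sphere_unif)"
        using z zX by (intro nn_integral_cong)
          (simp add: W_def n_def ennreal_mult[symmetric] power_divide less_imp_le)
      also have "\<dots> = ennreal (sqrt (1 - z * q) ^ n) * ennreal ((1 / sqrt (1 - z)) ^ card M)"
        using z by (subst nn_integral_cmult) (auto simp: nn_integral_sphere_unif_sq_fraction[OF u])
      finally show ?thesis using z by (simp add: K_def ennreal_mult)
    qed
    have K: "K \<le> exp (- (real n * r\<^sup>2))"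
    proof -
      have "2 * r\<^sup>2 \<le> p * ln (p / q) + (1 - p) * ln ((1 - p) / (1 - q))"
        using bernoulli_pinsker[of p q] p q by (simp add: q_def)
      moreover have "ln (1 - z) = ln p + ln (1 - q) - (ln q + ln (1 - p))"
        "ln (1 - z * q) = ln (1 - q) - ln (1 - p)"
        "ln (p / q) = ln p - ln q" "ln ((1 - p) / (1 - q)) = ln (1 - p) - ln (1 - q)"
        unfolding z1 z2 using p q by (simp_all add: ln_div ln_mult)
      ultimately have "ln (1 - z * q) - p * ln (1 - z) \<le> - 2 * r\<^sup>2"
        by (simp only:) (simp add: algebra_simps)
      then have "real n / 2 * (ln (1 - z * q) - p * ln (1 - z)) \<le> real n / 2 * (- 2 * r\<^sup>2)"
        by (intro mult_left_mono) auto
      then have *: "real n * ln (sqrt (1 - z * q)) - real (card M) * ln (sqrt (1 - z)) \<le> - (real n * r\<^sup>2)"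
        using n z by (simp add: p_def ln_sqrt algebra_simps)
      have "K = exp (real n * ln (sqrt (1 - z * q)) - real (card M) * ln (sqrt (1 - z)))"
        using z by (simp add: K_def exp_diff exp_of_nat_mult power_divide)
      then show ?thesis using * by simp
    qed
    have "emeasure P A = (\<integral>\<^sup>+vs. indicator A vs \<partial>P)" using Am by simp
    \<comment> \<open>Markov's inequality: on \<open>A\<close> the product is at least 1.
      Independence then factorises its integral.\<close>
    also have "\<dots> \<le> (\<integral>\<^sup>+vs. (\<Prod>i<nv. ennreal (W (vs i))) \<partial>P)"
    proof (rule nn_integral_mono)
      fix vs assume "vs \<in> space P"
      show "indicator A vs \<le> (\<Prod>i<nv. ennreal (W (vs i)))"
      proof (cases "vs \<in> A")
        case True
        then have "0 \<le> s * ((\<Sum>i<nv. sq_fraction u M (vs i)) - real nv * q)"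
          using s by (intro mult_nonneg_nonneg) (auto simp: A_def)
        then have "1 \<le> exp (s * ((\<Sum>i<nv. sq_fraction u M (vs i)) - real nv * q))" by simp
        also have "\<dots> = (\<Prod>i<nv. exp (s * (sq_fraction u M (vs i) - q)))"
          by (simp add: exp_sum[symmetric] sum_distrib_left[symmetric] sum_subtractf)
        also have "\<dots> \<le> (\<Prod>i<nv. W (vs i))" by (intro prod_mono conjI W) auto
        finally show ?thesis using True W0 by (simp add: prod_ennreal)
      qed simp
    qed
    also have "\<dots> = (\<Prod>i<nv. \<integral>\<^sup>+v. ennreal (W v) \<partial>sphere_unif)"
      unfolding P_def by (rule PS.product_nn_integral_prod) auto
    also have "\<dots> = ennreal (K ^ nv)" using K0 by (simp add: intW ennreal_power)
    finally have "measure P A \<le> K ^ nv"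
      using K0 by (simp add: measure_def enn2real_leI)
    also have "\<dots> \<le> exp (- (real n * r\<^sup>2)) ^ nv" using K K0 by (rule power_mono)
    also have "\<dots> = exp (- (real n * real nv * r\<^sup>2))"
      by (simp add: exp_of_nat_mult[symmetric] mult_ac)
    finally show ?thesis unfolding A_def q_def p_def n_def .
  qed
qed

section \<open>Stochastic Lanczos quadrature\<close>

text \<open>As a signed measure, \<open>mu\<close> minus its rule has weights of total absolute
  value 2 and annihilates degree \<open>2 * k - 1\<close>. Jackson's theorem with
  \<open>s = 2 * k - 1\<close> gives the denominator \<open>s + 2\<close>, and the 2 cancels the
  halving of the interval.\<close>

lemma gauss_quadrature_wasserstein:
  fixes w l :: "'i::finite \<Rightarrow> real"
  assumes w: "\<And>i. w i \<ge> 0" "(\<Sum>i\<in>UNIV. w i) = 1" and l: "\<And>i. l i \<in> {a..b}" and k: "0 < k"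
  defines "mu \<equiv> \<lambda>x. \<Sum>i\<in>UNIV. w i * (if l i \<le> x then 1 else 0)"
  shows "integrable lborel (\<lambda>x. \<bar>mu x - GQ k mu x\<bar>)"
    and "(\<integral>x. \<bar>mu x - GQ k mu x\<bar> \<partial>lborel) \<le> (b - a) * pi / real (2 * k + 1)"
proof -
  have "\<exists>theta d. (\<forall>j<k. d j \<ge> 0) \<and> (\<forall>j<k. theta j \<in> {a..b}) \<and>
    GQ k mu = (\<lambda>x. \<Sum>j<k. d j * (if theta j \<le> x then 1 else 0)) \<and>
    (\<forall>p::real poly. degree p \<le> 2 * k - 1 \<longrightarrow>
      (\<Sum>i\<in>UNIV. w i * poly p (l i)) = (\<Sum>j<k. d j * poly p (theta j)))"
    unfolding mu_def by (intro GQ_discrete w l k)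
  then obtain theta d where d: "\<forall>j<k. d j \<ge> 0" and theta: "\<forall>j<k. theta j \<in> {a..b}"
    and GQ: "GQ k mu = (\<lambda>x. \<Sum>j<k. d j * (if theta j \<le> x then 1 else 0))"
    and exact: "\<forall>p::real poly. degree p \<le> 2 * k - 1 \<longrightarrow>
      (\<Sum>i\<in>UNIV. w i * poly p (l i)) = (\<Sum>j<k. d j * poly p (theta j))"
    by (elim exE conjE) (rule that)
  have d1: "(\<Sum>j<k. d j) = 1" using exact[rule_format, of 1] w(2) by simp
  \<comment> \<open>Atoms of \<open>mu\<close> on the left, nodes with negated weights on the right;
    the disjoint sum lets points coincide.\<close>
  define I :: "('i + nat) set" where "I = UNIV <+> {..<k}"
  define c where "c = case_sum w (\<lambda>j. - d j)"
  define y where "y = case_sum l theta"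
  have sumI: "(\<Sum>i\<in>I. g i) = (\<Sum>i\<in>UNIV. g (Inl i)) + (\<Sum>j<k. g (Inr j))" for g :: "'i + nat \<Rightarrow> real"
    unfolding I_def by (subst sum.Plus) auto
  have ab: "a \<le> b" using l order.trans by fastforce
  have y: "y i \<in> {a..b}" if "i \<in> I" for i
    using that l theta by (auto simp: I_def y_def)
  have moments: "(\<Sum>i\<in>I. c i * poly p (y i)) = 0" if "degree p \<le> 2 * k - 1" for p :: "real poly"
    using exact that by (simp add: sumI c_def y_def sum_negf)
  have diff: "mu x - GQ k mu x = (\<Sum>i\<in>I. c i * (if y i \<le> x then 1 else 0))" for x
    unfolding GQ by (simp add: sumI c_def y_def mu_def sum_negf[symmetric] del: mult_minus_left)
  have c0: "(\<Sum>i\<in>I. c i) = 0" using w(2) d1 by (simp add: sumI c_def sum_negf)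
  show "integrable lborel (\<lambda>x. \<bar>mu x - GQ k mu x\<bar>)"
    unfolding diff using y c0 by (intro integrable_abs integrable_step_sum[of I y b]) auto
  have "(\<Sum>i\<in>I. \<bar>c i\<bar>) = 1 + (\<Sum>j<k. d j)" using w d by (simp add: sumI c_def)
  then have c2: "(\<Sum>i\<in>I. \<bar>c i\<bar>) = 2" using d1 by simp
  have k2: "2 * k - 1 + 2 = 2 * k + 1" using k by simp
  have "(\<Sum>i\<in>I. \<bar>c i\<bar>) * ((b - a) / 2 * pi / real (2 * k - 1 + 2)) = (b - a) * pi / real (2 * k + 1)"
    unfolding c2 k2 by (simp add: field_simps)
  then show "(\<integral>x. \<bar>mu x - GQ k mu x\<bar> \<partial>lborel) \<le> (b - a) * pi / real (2 * k + 1)"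
    using integral_abs_step_sum_le[of a b I y "2 * k - 1" c, OF ab y moments]
    unfolding diff by (simp only:)
qed

text \<open>Turns a lower deviation for \<open>M\<close> into an upper one for \<open>- M\<close>,
  so that the one-sided tail bound suffices.\<close>

lemma sq_fraction_Compl:
  assumes "orthonormal_frame u" "norm v = 1"
  shows "sq_fraction u (- M) v = 1 - sq_fraction u M v"
proof -
  have "(\<Sum>i\<in>UNIV. (v \<bullet> u i)\<^sup>2) = (\<Sum>i\<in>M. (v \<bullet> u i)\<^sup>2) + (\<Sum>i\<in>-M. (v \<bullet> u i)\<^sup>2)"
    using sum.union_disjoint[of M "- M" "\<lambda>i. (v \<bullet> u i)\<^sup>2"] by simp
  then show ?thesis using norm_sq_frame[OF assms(1), of v] assms(2)
    by (simp add: sq_fraction_def partial_sq_def)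
qed

text \<open>The quadrature error \<open>pi / (2 k + 1) < t / 6\<close> leaves room for a deviation of \<open>3 t / 4\<close> in the
  sampling error, which makes up for the tail bound \<open>exp (- n nv r\<^sup>2)\<close> being slightly weaker than
  the sharp sub-Gaussian \<open>exp (- (n + 2) nv r\<^sup>2)\<close>.\<close>

theorem theorem1:
  fixes A :: "real^'n^'n" and eta t :: real and nv k :: nat
  assumes "transpose A = A"
    and "0 < eta" and "eta < 1" and "0 < t"
    and "0 < nv" and "0 < k"
    and "real nv > 4 / (real CARD('n) + 2) / t\<^sup>2 * ln (2 * real CARD('n) / eta)"
    and "real k > 12 / t + 1/2"
  shows "\<exists>B \<in> sets (PiM {..<nv} (\<lambda>_. sphere_unif)).
           {vs \<in> space (PiM {..<nv} (\<lambda>_. sphere_unif)).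
              dW (CESM A) (SLQ A k nv vs) > t * spec_width A} \<subseteq> B
         \<and> measure (PiM {..<nv} (\<lambda>_. sphere_unif)) B < eta"
proof -
  obtain u l where u: "orthonormal_frame u" "\<And>i. A *v u i = l i *\<^sub>R u i"
    using symmetric_orthonormal_eigenframe[OF assms(1)] by blast
  define n where "n = real CARD('n)"
  have n: "n > 0" by (simp add: n_def)
  define a b where "a = Min (range l)" and "b = Max (range l)"
  have lab: "l i \<in> {a..b}" for i by (simp add: a_def b_def)
  have ab: "a \<le> b" using lab order.trans by fastforce
  have width: "spec_width A = b - a"
    using ab by (simp add: spec_width_def eigenvalues_eigenframe[OF u] a_def b_def)
  define r where "r = 3 * t / 4"
  have r: "r > 0" using assms by (simp add: r_def)
  define P where "P = PiM {..<nv} (\<lambda>_. sphere_unif :: (real^'n) measure)"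
  interpret P: prob_space P unfolding P_def by (intro prob_space_PiM prob_space_sphere_unif)
  \<comment> \<open>The distribution functions of \<open>A\<close> jump only at eigenvalues, so
    these level sets represent every real threshold. \<open>J\<close> leaves out the full set, where
    unit samples have no sampling error.\<close>
  define low where "low i = {j. l j \<le> l i}" for i
  define J where "J = {i. low i \<noteq> UNIV}"
  define Up where "Up M = {vs \<in> space P. (\<Sum>i<nv. sq_fraction u M (vs i)) > real nv * (real (card M) / real CARD('n) + r)}" for M
  have Up_sets [measurable]: "Up M \<in> sets P" for M unfolding Up_def P_def by measurable
  define N where "N = {vs \<in> space P. \<not> (\<forall>i<nv. norm (vs i) = 1)}"
  have N_sets [measurable]: "N \<in> sets P" unfolding N_def P_def by measurable
  have "AE vs in P. \<forall>i\<in>{..<nv}. norm (vs i) = 1"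
    unfolding P_def by (intro AE_finite_allI AE_PiM_component prob_space_sphere_unif AE_sphere_unif_norm) auto
  then have "AE vs in P. vs \<notin> N" by (rule eventually_mono) (auto simp: N_def)
  then have N0: "measure P N = 0" using AE_iff_null_sets[OF N_sets] by (simp add: measure_eq_0_null_sets)
  \<comment> \<open>The measurable cover: samples off the unit sphere, or an upper or lower
    deviation at some level.\<close>
  define B where "B = N \<union> (\<Union>i\<in>J. Up (low i) \<union> Up (- low i))"
  have "B \<in> sets P" unfolding B_def by measurable
  moreover have "measure P B < eta"
  proof -
    have lowne: "low i \<noteq> {}" for i by (auto simp: low_def)
    have "measure P B \<le> measure P N + measure P (\<Union>i\<in>J. Up (low i) \<union> Up (- low i))"
      unfolding B_def by (rule measure_Un_le) measurable
    also have "\<dots> \<le> 0 + (\<Sum>i\<in>J. measure P (Up (low i) \<union> Up (- low i)))"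
      unfolding N0 by (intro add_left_mono P.finite_measure_subadditive_finite) auto
    also have "\<dots> \<le> (\<Sum>i\<in>J. 2 * exp (- (n * real nv * r\<^sup>2)))"
      unfolding add_0
    proof (rule sum_mono)
      fix i assume "i \<in> J"
      then have "measure P (Up (low i)) \<le> exp (- (n * real nv * r\<^sup>2))"
        "measure P (Up (- low i)) \<le> exp (- (n * real nv * r\<^sup>2))"
        using lowne[of i] r unfolding Up_def P_def n_def J_def
        by (intro sphere_sq_fraction_upper_tail u; auto)+
      moreover have "measure P (Up (low i) \<union> Up (- low i)) \<le> measure P (Up (low i)) + measure P (Up (- low i))"
        by (rule measure_Un_le) measurable
      ultimately show "measure P (Up (low i) \<union> Up (- low i)) \<le> 2 * exp (- (n * real nv * r\<^sup>2))" by simp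
    qed
    also have "\<dots> = real (card J) * (2 * exp (- (n * real nv * r\<^sup>2)))" by simp
    also have "\<dots> < eta"
    proof (cases "J = {}")
      case True
      then show ?thesis using assms by simp
    next
      case False
      \<comment> \<open>Two distinct indices force \<open>n \<ge> 2\<close>, which makes
        \<open>(n + 2) / 4 \<le> 9 * n / 16\<close> and so absorbs the \<open>n + 2\<close> of the
        hypothesis on \<open>nv\<close>.\<close>
      then obtain i where "low i \<noteq> UNIV" by (auto simp: J_def)
      then obtain j where "j \<notin> low i" by auto
      then have "i \<noteq> j" by (auto simp: low_def)
      then have "card {i, j} = 2" by simp
      moreover have "card {i, j} \<le> CARD('n)" by (rule card_mono) auto
      ultimately have n2: "n \<ge> 2" by (simp add: n_def)
      have "ln (2 * n / eta) = 4 / (n + 2) / t\<^sup>2 * ln (2 * n / eta) * ((n + 2) * t\<^sup>2 / 4)"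
        using n assms(4) by simp
      also have "\<dots> < real nv * ((n + 2) * t\<^sup>2 / 4)"
        using assms n by (intro mult_strict_right_mono) (auto simp: n_def)
      also have "\<dots> = real nv * t\<^sup>2 * ((n + 2) / 4)" by simp
      also have "\<dots> \<le> real nv * t\<^sup>2 * (n * 9 / 16)"
        using n2 by (intro mult_left_mono) auto
      also have "\<dots> = n * real nv * r\<^sup>2"
        by (simp add: r_def power2_eq_square)
      finally have "exp (- (n * real nv * r\<^sup>2)) < exp (- ln (2 * n / eta))" by simp
      also have "\<dots> = eta / (2 * n)"
        using n assms by (simp add: exp_minus)
      finally have lt: "2 * exp (- (n * real nv * r\<^sup>2)) < eta / n" using n by (simp add: field_simps)
      have "real (card J) * (2 * exp (- (n * real nv * r\<^sup>2))) \<le> n * (2 * exp (- (n * real nv * r\<^sup>2)))"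
        unfolding n_def by (intro mult_right_mono) (auto intro!: card_mono)
      also have "\<dots> < n * (eta / n)" using n by (intro mult_strict_left_mono lt)
      also have "\<dots> = eta" using n by simp
      finally show ?thesis .
    qed
    finally show ?thesis .
  qed
  moreover have "{vs \<in> space P. dW (CESM A) (SLQ A k nv vs) > t * spec_width A} \<subseteq> B"
  proof -
    have "dW (CESM A) (SLQ A k nv vs) \<le> t * spec_width A" if vs: "vs \<in> space P" "vs \<notin> B" for vs
    proof -
      have norm1: "norm (vs i) = 1" if "i < nv" for i using vs that by (auto simp: B_def N_def)
      define Psi where "Psi i = wCESM A (vs i)" for i
      have Psi: "Psi i = (\<lambda>x. \<Sum>j\<in>UNIV. (vs i \<bullet> u j)\<^sup>2 * (if l j \<le> x then 1 else 0))" for i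
        unfolding Psi_def by (rule wCESM_eigenframe[OF u])
      have w1: "(\<Sum>j\<in>UNIV. (vs i \<bullet> u j)\<^sup>2) = 1" if "i < nv" for i
        using norm_sq_frame[OF u(1), of "vs i"] norm1[OF that] by simp
      have quad: "integrable lborel (\<lambda>x. \<bar>Psi i x - GQ k (Psi i) x\<bar>)"
        "(\<integral>x. \<bar>Psi i x - GQ k (Psi i) x\<bar> \<partial>lborel) \<le> (b - a) * pi / real (2 * k + 1)" if "i < nv" for i
        unfolding Psi by (rule gauss_quadrature_wasserstein[OF _ w1[OF that] lab assms(6)]; simp)+
      \<comment> \<open>Outside \<open>{a..<b}\<close> both functions are 0 or both are 1; hence the
        indicator, whose integral yields the factor \<open>b - a\<close>.\<close>
      have sample: "\<bar>CESM A x - (\<Sum>i<nv. Psi i x) / real nv\<bar> \<le> r * indicator {a..<b} x" for x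
      proof -
        define M where "M = {j. l j \<le> x}"
        have Phi: "CESM A x = real (card M) / real CARD('n)"
          unfolding M_def by (rule CESM_eigenframe[OF u])
        have PsiM: "Psi i x = (\<Sum>j\<in>M. (vs i \<bullet> u j)\<^sup>2)" for i
          unfolding Psi M_def by (rule sum.mono_neutral_cong_right) auto
        consider "M = {}" | "M = UNIV" | "M \<noteq> {}" "M \<noteq> UNIV" by blast
        then show ?thesis
        proof cases
          case 1
          then show ?thesis using r by (simp add: Phi PsiM)
        next
          case 2
          then show ?thesis using r assms(5) w1 by (simp add: Phi PsiM)
        next
          case 3
          have x: "x \<in> {a..<b}"
          proof -
            obtain i j where "l i \<le> x" "\<not> l j \<le> x" using 3 by (auto simp: M_def)
            then show ?thesis using lab[of i] lab[of j] by auto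
          qed
          \<comment> \<open>The largest eigenvalue not exceeding \<open>x\<close>: the level set at
            \<open>x\<close> equals the one at \<open>m\<close>, so the finite union bound controls
            all real \<open>x\<close>.\<close>
          define m where "m = Max (l ` M)"
          have "m \<in> l ` M" unfolding m_def using 3 by (intro Max_in) auto
          then obtain i0 where i0: "i0 \<in> M" "l i0 = m" by auto
          have "l j \<le> m" if "j \<in> M" for j unfolding m_def using that by (intro Max_ge) auto
          then have "M = low i0" using i0 by (auto simp: low_def M_def intro: order.trans)
          then have "i0 \<in> J" using 3 by (simp add: J_def)
          have up: "(\<Sum>i<nv. sq_fraction u M' (vs i)) \<le> real nv * (real (card M') / real CARD('n) + r)"
            if "M' = M \<or> M' = - M" for M'
            using vs that \<open>M = low i0\<close> \<open>i0 \<in> J\<close> by (auto simp: B_def Up_def not_less)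
          have XP: "sq_fraction u M (vs i) = Psi i x" if "i < nv" for i
            using norm1[OF that] by (simp add: sq_fraction_def partial_sq_def PsiM)
          have "real (card (- M)) = n - real (card M)"
            by (simp add: n_def Compl_eq_Diff_UNIV card_Diff_subset card_mono of_nat_diff)
          then have cC: "real (card (- M)) / n = 1 - real (card M) / n"
            using n by (simp add: diff_divide_distrib)
          have upper: "(\<Sum>i<nv. Psi i x) \<le> real nv * (real (card M) / n + r)"
            using up[of M] XP by (simp add: n_def)
          have "(\<Sum>i<nv. sq_fraction u (- M) (vs i)) = (\<Sum>i<nv. 1 - Psi i x)"
            using norm1 XP by (intro sum.cong) (simp_all add: sq_fraction_Compl[OF u(1)])
          then have "real nv - (\<Sum>i<nv. Psi i x) \<le> real nv * (real (card (- M)) / n + r)"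
            using up[of "- M"] by (simp add: n_def sum_subtractf)
          then have lower: "real nv * (real (card M) / n - r) \<le> (\<Sum>i<nv. Psi i x)"
            unfolding cC by (simp add: algebra_simps)
          have nv: "real nv > 0" using assms(5) by simp
          have "(\<Sum>i<nv. Psi i x) / real nv \<le> real (card M) / n + r"
            "real (card M) / n - r \<le> (\<Sum>i<nv. Psi i x) / real nv"
            using upper lower nv by (simp_all add: pos_divide_le_eq pos_le_divide_eq mult.commute)
          then show ?thesis using x by (simp add: Phi n_def abs_le_iff)
        qed
      qed
      let ?R = "\<lambda>x. r * indicator {a..<b} x + (\<Sum>i<nv. \<bar>Psi i x - GQ k (Psi i) x\<bar>) / real nv"
      have pt: "\<bar>CESM A x - SLQ A k nv vs x\<bar> \<le> ?R x" for x
      proof -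
        have "CESM A x - SLQ A k nv vs x = (CESM A x - (\<Sum>i<nv. Psi i x) / real nv)
            + (\<Sum>i<nv. Psi i x - GQ k (Psi i) x) / real nv"
          by (simp add: SLQ_def Psi_def sum_subtractf diff_divide_distrib)
        also have "\<bar>\<dots>\<bar> \<le> \<bar>CESM A x - (\<Sum>i<nv. Psi i x) / real nv\<bar>
            + \<bar>(\<Sum>i<nv. Psi i x - GQ k (Psi i) x) / real nv\<bar>" by (rule abs_triangle_ineq)
        also have "\<dots> \<le> ?R x"
          by (intro add_mono sample) (auto simp: abs_divide intro!: divide_right_mono sum_abs)
        finally show ?thesis .
      qed
      have int1: "integrable lborel (\<lambda>x. r * indicator {a..<b} x :: real)"
        by (intro integrable_mult_right integrable_real_indicator emeasure_lborel_Ico_finite) auto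
      have int2: "integrable lborel (\<lambda>x. (\<Sum>i<nv. \<bar>Psi i x - GQ k (Psi i) x\<bar>) / real nv)"
        using quad by (intro integrable_divide Bochner_Integration.integrable_sum) auto
      have "dW (CESM A) (SLQ A k nv vs) \<le> (\<integral>x. ?R x \<partial>lborel)"
        unfolding dW_def
        using int1 int2 pt by (intro integral_mono' Bochner_Integration.integrable_add) (auto intro: order.trans[OF abs_ge_zero])
      also have "\<dots> = r * (b - a) + (\<Sum>i<nv. \<integral>x. \<bar>Psi i x - GQ k (Psi i) x\<bar> \<partial>lborel) / real nv"
        using int1 int2 quad(1) ab by (subst Bochner_Integration.integral_add) (auto simp: Bochner_Integration.integral_sum)
      also have "\<dots> \<le> r * (b - a) + (\<Sum>i<nv. (b - a) * pi / real (2 * k + 1)) / real nv"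
        using quad(2) by (intro add_left_mono divide_right_mono sum_mono) auto
      also have "\<dots> = (b - a) * (r + pi / real (2 * k + 1))"
        using assms(5) by (simp add: distrib_left mult.commute[of r])
      also have "\<dots> \<le> (b - a) * t"
      proof (intro mult_left_mono)
        \<comment> \<open>The hypothesis on \<open>k\<close> gives
          \<open>2 * k + 1 > 24 / t\<close>, and \<open>6 * pi < 24\<close>.\<close>
        have "24 < t * real (2 * k + 1)" using assms(4,8) by (simp add: field_simps)
        then have "pi * 6 \<le> t * real (2 * k + 1)" using pi_less_4 by linarith
        then have "pi / real (2 * k + 1) \<le> t / 6"
          by (simp add: pos_divide_le_eq pos_le_divide_eq mult.commute)
        then show "r + pi / real (2 * k + 1) \<le> t" using assms(4) by (simp add: r_def)
      qed (use ab in simp)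
      finally show ?thesis by (simp add: width mult.commute)
    qed
    then show ?thesis by (auto simp: not_less[symmetric])
  qed
  ultimately show ?thesis unfolding P_def by blast
qed

end
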